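(* Let $G$ be a semitopological semigroup which admits a continuous involution. (i) If a right topological semigroup $S$ admits a continuous involution, then $S$ is semitopological. (ii) If $(\delta,S)$ is an involutive right topological compactification of $G$, then $S$ is semitopological, and $\mathcal{C}(S)\circ\delta$ is involutive, i.e. closed under $f\mapsto f^*$ (with this involution isometric). (iii) The weakly almost periodic compactification $(\varepsilon_{\mathcal{WAP}},G^{\mathcal{WAP}})$ is an involutive compactification. In particular, $(\varepsilon_{\mathcal{WAP}},G^{\mathcal{WAP}})$ is the universal involutive compactification of $G$ (every involutive right topological compactification of $G$ is a factor of it).
   Context: A semitopological semigroup has separately continuous multiplication; $S$ is a right topological semigroup if $s\mapsto st$ is continuous for each $t\in S$. An involution on a semigroup is a map $s\mapsto s^*$ with $(s^* )^*=s$, $(st)^*=t^*s^*$. For $f\in\mathcal{CB}(G)$ (continuous bounded functions), $f^*(s)=\overline{f(s^* )}$. A right topological compactification of $G$ is a pair $(\delta,S)$ with $S$ a compact right topological semigroup and $\delta:G\to S$ a continuous homomorphism with dense range contained in the topological centre $Z_T(S)=\{t\in S:s\mapsto ts\text{ is continuous}\}$. It is involutive if there is a continuous involution $x\mapsto x^*$ on $S$ with $\delta(s^* )=\delta(s)^*$ for $s\in G$. $(\delta,S)$ is a factor of $(\epsilon,T)$, written $(\delta,S)\leq(\epsilon,T)$, if there is a continuous homomorphism $\theta:T\to S$ with $\theta\circ\epsilon=\delta$. $\mathcal{WAP}(G)$ is the C*-algebra of weakly almost periodic functions: $f\in\mathcal{CB}(G)$ for which $\{s\cdot f:s\in G\}$,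 $s\cdot f(t)=f(ts)$ (equivalently the set of left translates $f\cdot s(t)=f(st)$) is relatively weakly compact in $\mathcal{CB}(G)$. $G^{\mathcal{WAP}}$ is its Gelfand spectrum with Arens product and $\varepsilon_{\mathcal{WAP}}$ the evaluation map; it is the universal semitopological compactification of $G$. *)

theory Defs
  imports "HOL-Analysis.Analysis"
begin

section \<open>Semigroups with a topology\<close>

text \<open>
  A semigroup with a topology is a pair \<open>(T, m)\<close>; its underlying set is \<^term>\<open>topspace T\<close>, and the
  values of \<open>m\<close> outside that set are irrelevant.  A type \<open>'g\<close> of class \<^class>\<open>semigroup_mult\<close> and
  \<^class>\<open>topological_space\<close> is the pair \<open>(euclidean, (*))\<close>.
\<close>

definition semigroup_on :: "'a set \<Rightarrow> ('a \<Rightarrow> 'a \<Rightarrow> 'a) \<Rightarrow> bool" where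
  "semigroup_on A m \<longleftrightarrow>
     (\<forall>s\<in>A. \<forall>t\<in>A. m s t \<in> A) \<and>
     (\<forall>r\<in>A. \<forall>s\<in>A. \<forall>t\<in>A. m (m r s) t = m r (m s t))"

definition right_topological_semigroup :: "'a topology \<Rightarrow> ('a \<Rightarrow> 'a \<Rightarrow> 'a) \<Rightarrow> bool" where
  "right_topological_semigroup T m \<longleftrightarrow>
     semigroup_on (topspace T) m \<and> (\<forall>t\<in>topspace T. continuous_map T T (\<lambda>s. m s t))"

definition semitopological_semigroup :: "'a topology \<Rightarrow> ('a \<Rightarrow> 'a \<Rightarrow> 'a) \<Rightarrow> bool" where
  "semitopological_semigroup T m \<longleftrightarrow>
     semigroup_on (topspace T) m \<and>
     (\<forall>t\<in>topspace T. continuous_map T T (\<lambda>s. m s t)) \<and>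
     (\<forall>t\<in>topspace T. continuous_map T T (\<lambda>s. m t s))"

definition topological_centre :: "'a topology \<Rightarrow> ('a \<Rightarrow> 'a \<Rightarrow> 'a) \<Rightarrow> 'a set" where
  "topological_centre T m = {t \<in> topspace T. continuous_map T T (\<lambda>s. m t s)}"

definition involution_on :: "'a set \<Rightarrow> ('a \<Rightarrow> 'a \<Rightarrow> 'a) \<Rightarrow> ('a \<Rightarrow> 'a) \<Rightarrow> bool" where
  "involution_on A m star \<longleftrightarrow>
     (\<forall>s\<in>A. star s \<in> A) \<and>
     (\<forall>s\<in>A. star (star s) = s) \<and>
     (\<forall>s\<in>A. \<forall>t\<in>A. star (m s t) = m (star t) (star s))"

definition continuous_involution :: "'a topology \<Rightarrow> ('a \<Rightarrow> 'a \<Rightarrow> 'a) \<Rightarrow> ('a \<Rightarrow> 'a) \<Rightarrow> bool" where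
  "continuous_involution T m star \<longleftrightarrow>
     involution_on (topspace T) m star \<and> continuous_map T T star"


section \<open>Compactifications\<close>

text \<open>Compact spaces are understood to be Hausdorff.\<close>

definition right_topological_compactification ::
    "('g::{topological_space,semigroup_mult} \<Rightarrow> 's) \<Rightarrow> 's topology \<Rightarrow> ('s \<Rightarrow> 's \<Rightarrow> 's) \<Rightarrow> bool" where
  "right_topological_compactification \<delta> S m \<longleftrightarrow>
     compact_space S \<and> Hausdorff_space S \<and> right_topological_semigroup S m \<and>
     continuous_map euclidean S \<delta> \<and>
     (\<forall>s t. \<delta> (s * t) = m (\<delta> s) (\<delta> t)) \<and>
     S closure_of (range \<delta>) = topspace S \<and>
     range \<delta> \<subseteq> topological_centre S m"

definition involutive_compactification ::
    "('g \<Rightarrow> 'g) \<Rightarrow> ('g::{topological_space,semigroup_mult} \<Rightarrow> 's) \<Rightarrow> 's topology \<Rightarrow> ('s \<Rightarrow> 's \<Rightarrow> 's) \<Rightarrow> bool"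
  where
  "involutive_compactification star \<delta> S m \<longleftrightarrow>
     right_topological_compactification \<delta> S m \<and>
     (\<exists>starS. continuous_involution S m starS \<and> (\<forall>s. \<delta> (star s) = starS (\<delta> s)))"

text \<open>\<open>factor_of \<delta> S m \<epsilon> T n\<close> is the relation \<open>(\<delta>, S) \<le> (\<epsilon>, T)\<close>.\<close>

definition factor_of ::
    "('g \<Rightarrow> 's) \<Rightarrow> 's topology \<Rightarrow> ('s \<Rightarrow> 's \<Rightarrow> 's) \<Rightarrow> ('g \<Rightarrow> 't) \<Rightarrow> 't topology \<Rightarrow> ('t \<Rightarrow> 't \<Rightarrow> 't) \<Rightarrow> bool" where
  "factor_of \<delta> S m \<epsilon> T n \<longleftrightarrow>
     (\<exists>\<theta>. continuous_map T S \<theta> \<and>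
          (\<forall>x\<in>topspace T. \<forall>y\<in>topspace T. \<theta> (n x y) = m (\<theta> x) (\<theta> y)) \<and>
          (\<forall>s. \<theta> (\<epsilon> s) = \<delta> s))"


section \<open>The algebra of bounded continuous functions\<close>

text \<open>
  The type \<open>'g \<Rightarrow>\<^sub>C complex\<close> with its norm is the Banach space \<open>CB(G)\<close>; the library provides only its
  real vector space structure.
\<close>

definition cb_scale :: "complex \<Rightarrow> ('g::topological_space \<Rightarrow>\<^sub>C complex) \<Rightarrow> ('g \<Rightarrow>\<^sub>C complex)" where
  "cb_scale c f = Bcontfun (\<lambda>x. c * f x)"

definition cb_mult ::
    "('g::topological_space \<Rightarrow>\<^sub>C complex) \<Rightarrow> ('g \<Rightarrow>\<^sub>C complex) \<Rightarrow> ('g \<Rightarrow>\<^sub>C complex)" where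
  "cb_mult f g = Bcontfun (\<lambda>x. f x * g x)"

lemma apply_cb_mult: "cb_mult f g x = f x * g x"
proof -
  obtain a where a: "norm (f x) \<le> a" for x
    using bounded_apply_bcontfun[of f] by (auto simp: bounded_iff)
  obtain b where b: "norm (g x) \<le> b" for x
    using bounded_apply_bcontfun[of g] by (auto simp: bounded_iff)
  have "norm (f x * g x) \<le> a * b" for x
    unfolding norm_mult using a b order_trans[OF norm_ge_zero a] by (intro mult_mono) auto
  then have "(\<lambda>x. f x * g x) \<in> bcontfun"
    by (auto simp: bcontfun_def bounded_iff intro!: continuous_intros)
  then show ?thesis by (simp add: cb_mult_def Bcontfun_inverse)
qed

lemma apply_cb_scale: "cb_scale c f x = c * f x"
  using apply_cb_mult[of "const_bcontfun c" f x]
  by (simp add: cb_mult_def cb_scale_def const_bcontfun.rep_eq)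

text \<open>
  \<^const>\<open>Bcontfun\<close> is meaningful only on bounded continuous functions.  For the next three
  definitions this holds when multiplication, respectively \<open>star\<close>, is (separately) continuous;
  see the lemmas below.
\<close>

definition cb_star ::
    "('g \<Rightarrow> 'g) \<Rightarrow> ('g::topological_space \<Rightarrow>\<^sub>C complex) \<Rightarrow> ('g \<Rightarrow>\<^sub>C complex)" where
  "cb_star star f = Bcontfun (\<lambda>s. cnj (f (star s)))"

text \<open>\<open>ltr s f\<close> is \<open>s \<sqdot> f\<close> and \<open>rtr f s\<close> is \<open>f \<sqdot> s\<close>.\<close>

definition ltr ::
    "'g \<Rightarrow> ('g::{topological_space,semigroup_mult} \<Rightarrow>\<^sub>C complex) \<Rightarrow> ('g \<Rightarrow>\<^sub>C complex)" where
  "ltr s f = Bcontfun (\<lambda>t. f (t * s))"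

definition rtr ::
    "('g::{topological_space,semigroup_mult} \<Rightarrow>\<^sub>C complex) \<Rightarrow> 'g \<Rightarrow> ('g \<Rightarrow>\<^sub>C complex)" where
  "rtr f s = Bcontfun (\<lambda>t. f (s * t))"

lemma bcontfun_compose_continuous:
  fixes f :: "'g::topological_space \<Rightarrow>\<^sub>C complex"
  assumes "continuous_on UNIV h"
  shows "(\<lambda>t. f (h t)) \<in> bcontfun"
proof -
  have "bounded (range (\<lambda>t. f (h t)))"
    by (rule bounded_subset[OF bounded_apply_bcontfun[of f]]) auto
  moreover have "continuous_on UNIV (\<lambda>t. f (h t))"
    by (rule continuous_on_compose2[OF continuous_on_apply_bcontfun[of UNIV f] assms]) auto
  ultimately show ?thesis by (simp add: bcontfun_def)
qed

lemma apply_cb_star: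
  fixes f :: "'g::topological_space \<Rightarrow>\<^sub>C complex"
  assumes "continuous_on UNIV star"
  shows "cb_star star f s = cnj (f (star s))"
proof -
  have "(\<lambda>s. cnj (f (star s))) \<in> bcontfun"
    using bcontfun_compose_continuous[OF assms, of f]
    by (auto simp: bcontfun_def bounded_iff intro!: continuous_intros)
  then show ?thesis by (simp add: cb_star_def Bcontfun_inverse)
qed

lemma apply_ltr:
  fixes f :: "'g::{topological_space,semigroup_mult} \<Rightarrow>\<^sub>C complex"
  assumes "semitopological_semigroup (euclidean :: 'g topology) (*)"
  shows "ltr s f t = f (t * s)"
  unfolding ltr_def
  by (subst Bcontfun_inverse[OF bcontfun_compose_continuous])
     (use assms in \<open>auto simp: semitopological_semigroup_def\<close>)

lemma apply_rtr:
  fixes f :: "'g::{topological_space,semigroup_mult} \<Rightarrow>\<^sub>C complex"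
  assumes "semitopological_semigroup (euclidean :: 'g topology) (*)"
  shows "rtr f s t = f (s * t)"
  unfolding rtr_def
  by (subst Bcontfun_inverse[OF bcontfun_compose_continuous])
     (use assms in \<open>auto simp: semitopological_semigroup_def\<close>)

text \<open>\<open>C(S) \<circ> \<delta>\<close>, for compact \<open>S\<close> and continuous \<open>\<delta>\<close>.\<close>

definition C_comp :: "'s topology \<Rightarrow> ('g::topological_space \<Rightarrow> 's) \<Rightarrow> ('g \<Rightarrow>\<^sub>C complex) set" where
  "C_comp S \<delta> = {h. \<exists>f. continuous_map S euclidean f \<and> apply_bcontfun h = f \<circ> \<delta>}"

definition isometric_involution_on ::
    "('g::topological_space \<Rightarrow>\<^sub>C complex) set \<Rightarrow> (('g \<Rightarrow>\<^sub>C complex) \<Rightarrow> ('g \<Rightarrow>\<^sub>C complex)) \<Rightarrow> bool" where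
  "isometric_involution_on A st \<longleftrightarrow>
     (\<forall>f\<in>A. st f \<in> A \<and> st (st f) = f \<and> norm (st f) = norm f) \<and>
     (\<forall>f\<in>A. \<forall>g\<in>A. st (f + g) = st f + st g \<and> st (cb_mult f g) = cb_mult (st g) (st f)) \<and>
     (\<forall>f\<in>A. \<forall>c. st (cb_scale c f) = cb_scale (cnj c) (st f))"


section \<open>Weakly almost periodic functions\<close>

definition cb_dual :: "(('g::topological_space \<Rightarrow>\<^sub>C complex) \<Rightarrow> complex) set" where
  "cb_dual = {\<phi>. bounded_linear \<phi> \<and> (\<forall>c f. \<phi> (cb_scale c f) = c * \<phi> f)}"

definition cb_weak_topology :: "('g::topological_space \<Rightarrow>\<^sub>C complex) topology" where
  "cb_weak_topology = topology_generated_by {\<phi> -` U | \<phi> U. \<phi> \<in> cb_dual \<and> open U}"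

definition wap :: "('g::{topological_space,semigroup_mult} \<Rightarrow>\<^sub>C complex) set" where
  "wap = {f. compactin cb_weak_topology (cb_weak_topology closure_of (range (\<lambda>s. ltr s f)))}"


section \<open>Gelfand spectrum and Arens product\<close>

text \<open>
  The spectrum of a subalgebra \<open>A\<close> of \<open>CB(G)\<close>: the nonzero multiplicative linear functionals on \<open>A\<close>,
  as extensional functions, with the topology of pointwise convergence on \<open>A\<close>.
\<close>

definition characters ::
    "('g::topological_space \<Rightarrow>\<^sub>C complex) set \<Rightarrow> (('g \<Rightarrow>\<^sub>C complex) \<Rightarrow> complex) set" where
  "characters A = {x \<in> extensional A.
     (\<forall>f\<in>A. \<forall>g\<in>A. x (f + g) = x f + x g \<and> x (cb_mult f g) = x f * x g) \<and>
     (\<forall>f\<in>A. \<forall>c. x (cb_scale c f) = c * x f) \<and>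
     (\<exists>f\<in>A. x f \<noteq> 0)}"

definition spectrum ::
    "('g::topological_space \<Rightarrow>\<^sub>C complex) set \<Rightarrow> (('g \<Rightarrow>\<^sub>C complex) \<Rightarrow> complex) topology" where
  "spectrum A = subtopology (product_topology (\<lambda>_. euclidean) A) (characters A)"

definition evaluation ::
    "('g::topological_space \<Rightarrow>\<^sub>C complex) set \<Rightarrow> 'g \<Rightarrow> (('g \<Rightarrow>\<^sub>C complex) \<Rightarrow> complex)" where
  "evaluation A s = (\<lambda>f\<in>A. apply_bcontfun f s)"

text \<open>
  For functionals \<open>x\<close>, \<open>y\<close> on \<open>A\<close> and \<open>f \<in> A\<close>, the function \<open>y \<sqdot> f\<close> is \<open>s \<mapsto> y (f \<sqdot> s)\<close>, and the Arens
  product is \<open>(x y)(f) = x (y \<sqdot> f)\<close>.  With this convention \<open>x \<mapsto> x y\<close> is continuous, and evaluation at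
  \<open>s\<close> acts by \<open>f \<mapsto> s \<sqdot> f\<close>.  It requires that \<open>A\<close> contain every \<open>f \<sqdot> s\<close> and \<open>y \<sqdot> f\<close>, as \<^const>\<open>wap\<close> does.
\<close>

definition arens_action ::
    "(('g::{topological_space,semigroup_mult} \<Rightarrow>\<^sub>C complex) \<Rightarrow> complex) \<Rightarrow> ('g \<Rightarrow>\<^sub>C complex) \<Rightarrow> ('g \<Rightarrow>\<^sub>C complex)"
  where
  "arens_action y f = Bcontfun (\<lambda>s. y (rtr f s))"

definition arens_product ::
    "('g::{topological_space,semigroup_mult} \<Rightarrow>\<^sub>C complex) set \<Rightarrow>
     (('g \<Rightarrow>\<^sub>C complex) \<Rightarrow> complex) \<Rightarrow> (('g \<Rightarrow>\<^sub>C complex) \<Rightarrow> complex) \<Rightarrow> (('g \<Rightarrow>\<^sub>C complex) \<Rightarrow> complex)"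
  where
  "arens_product A x y = (\<lambda>f\<in>A. x (arens_action y f))"

end

theory Submission
  imports Defs
begin

text \<open>
  A function \<open>f\<close> is weakly almost periodic iff
  \<open>lim\<^bsub>s\<rightarrow>U\<^esub> lim\<^bsub>t\<rightarrow>V\<^esub> f (s t) = lim\<^bsub>t\<rightarrow>V\<^esub> lim\<^bsub>s\<rightarrow>U\<^esub> f (s t)\<close> for all ultrafilters \<open>U\<close>, \<open>V\<close>
  on \<open>G\<close> (Grothendieck). This condition is symmetric in the two factors, so it is preserved by \<open>f \<mapsto> f\<^sup>*\<close>,
  and it visibly passes to sums, products and inverses. The latter makes every character of \<open>wap\<close> a limit
  of evaluations along some ultrafilter; the Arens product of the characters of \<open>U\<close> and \<open>V\<close> is then the
  left-hand iterated limit, and the criterion says precisely that \<open>x\<^sup>*(f) = cnj (x (f\<^sup>*))\<close> reverses products.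
  For a compact semitopological \<open>S\<close> both iterated limits of \<open>F \<circ> \<delta>\<close> are \<open>F (p q)\<close>, where \<open>p\<close> and \<open>q\<close> are the
  limits of \<open>\<delta>\<close> along \<open>U\<close> and \<open>V\<close>; hence \<open>C(S) \<circ> \<delta> \<subseteq> wap\<close>, which gives the factor map.

  The hard half of the criterion needs no representation of functionals by measures: if \<open>h\<^sub>t \<rightarrow> 0\<close>
  pointwise but not weakly, the modulus \<open>\<bar>\<phi>\<bar>\<close> of a functional serves as a measure for which the sets where
  \<open>\<bar>h\<^sub>t\<bar>\<close> is large are uniformly non-null, and one finds a sequence of them with the finite intersection
  property.
\<close>


section \<open>Ultrafilters and double limits\<close>

definition ultrafilter :: "'a filter \<Rightarrow> bool" where
  "ultrafilter F \<longleftrightarrow> F \<noteq> bot \<and> (\<forall>P. eventually P F \<or> eventually (\<lambda>x. \<not> P x) F)"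

lemma ultrafilter_not_bot: "ultrafilter F \<Longrightarrow> F \<noteq> bot"
  by (simp add: ultrafilter_def)

lemma ultrafilter_not_eventually:
  assumes "ultrafilter F"
  shows "\<not> eventually P F \<longleftrightarrow> eventually (\<lambda>x. \<not> P x) F"
proof -
  have "\<not> (eventually P F \<and> eventually (\<lambda>x. \<not> P x) F)"
    using assms eventually_conj[of P F "\<lambda>x. \<not> P x"] by (auto simp: ultrafilter_def)
  then show ?thesis using assms by (auto simp: ultrafilter_def)
qed

lemma ultrafilter_filtermap: "ultrafilter F \<Longrightarrow> ultrafilter (filtermap f F)"
  by (simp add: ultrafilter_def eventually_filtermap filtermap_bot_iff)

lemma ultrafilter_exists:
  fixes F :: "'a filter"
  assumes "F \<noteq> bot"
  obtains U where "ultrafilter U" "U \<le> F"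
proof -
  let ?A = "{G. G \<noteq> bot \<and> G \<le> F}"
  \<comment> \<open>The order is reversed, so that Zorn's lemma yields a minimal nontrivial filter.
    The infimum of a chain stays nontrivial because a chain is a filter base.\<close>
  have "\<exists>m\<in>?A. \<forall>a\<in>?A. a \<le> m \<longrightarrow> a = m"
  proof (rule predicate_Zorn)
    show "partial_order_on ?A (relation_of (\<lambda>a b. b \<le> a) ?A)"
      by (rule partial_order_on_relation_ofI) auto
  next
    fix C assume C: "C \<in> Chains (relation_of (\<lambda>a b. b \<le> a) ?A)"
    show "\<exists>u\<in>?A. \<forall>a\<in>C. u \<le> a"
    proof (cases "C = {}")
      case True
      then show ?thesis using assms by auto
    next
      case False
      have lin: "a \<le> b \<or> b \<le> a" "a \<in> ?A" if "a \<in> C" "b \<in> C" for a b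
        using C that by (auto simp: Chains_def relation_of_def)
      have "eventually P (Inf C) \<longleftrightarrow> (\<exists>b\<in>C. eventually P b)" for P
        by (rule eventually_Inf_base[OF False]) (metis lin(1) inf.absorb1 inf.absorb2 order_refl)
      then have "Inf C \<noteq> bot"
        using lin(2) by (auto simp flip: eventually_False)
      moreover have "Inf C \<le> F"
      proof -
        obtain a where "a \<in> C" using False by blast
        then show ?thesis using lin(2) by (auto intro: Inf_lower2)
      qed
      ultimately show ?thesis by (auto intro!: bexI[of _ "Inf C"] Inf_lower)
    qed
  qed
  then obtain U where U: "U \<noteq> bot" "U \<le> F" and max: "\<And>G. G \<noteq> bot \<Longrightarrow> G \<le> U \<Longrightarrow> G = U"
    by (auto intro: order_trans)
  have "eventually P U \<or> eventually (\<lambda>x. \<not> P x) U" for P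
  proof (rule disjCI)
    \<comment> \<open>By minimality, adjoining \<open>P\<close> to \<open>U\<close> changes nothing
      as soon as the result is nontrivial.\<close>
    assume "\<not> eventually (\<lambda>x. \<not> P x) U"
    then have "inf U (principal {x. P x}) \<noteq> bot"
      by (auto simp: eventually_inf_principal simp flip: eventually_False)
    then have "inf U (principal {x. P x}) = U"
      using max by simp
    then show "eventually P U"
      using eventually_inf_principal[of P U "{x. P x}"] by simp
  qed
  with U have "ultrafilter U" by (simp add: ultrafilter_def)
  with U show thesis using that by blast
qed

text \<open>Otherwise every point of \<open>K\<close> has an open neighbourhood which
  \<open>f\<close>, by the ultrafilter dichotomy, eventually avoids; finitely many of these cover
  \<open>K\<close>.\<close>

lemma compactin_ultrafilter_limit:
  assumes "compactin T K" "ultrafilter F" "\<forall>\<^sub>F x in F. f x \<in> K"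
  obtains l where "l \<in> K" "limitin T f l F"
proof (rule ccontr)
  assume "\<not> thesis"
  then have "\<forall>l\<in>K. \<not> limitin T f l F" using that by blast
  then have "\<forall>l\<in>K. \<exists>U. openin T U \<and> l \<in> U \<and> \<not> (\<forall>\<^sub>F x in F. f x \<in> U)"
    using compactin_subset_topspace[OF assms(1)] by (force simp: limitin_def)
  then obtain U where U: "\<And>l. l \<in> K \<Longrightarrow> openin T (U l) \<and> l \<in> U l \<and> (\<forall>\<^sub>F x in F. f x \<notin> U l)"
    unfolding ultrafilter_not_eventually[OF assms(2)] by metis
  obtain \<F> where \<F>: "finite \<F>" "\<F> \<subseteq> U ` K" "K \<subseteq> \<Union>\<F>"
    using compactinD[OF assms(1), of "U ` K"] U by blast
  have "\<forall>\<^sub>F x in F. \<forall>V\<in>\<F>. f x \<notin> V"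
    using \<F> U by (intro eventually_ball_finite) auto
  with assms(3) have "\<forall>\<^sub>F x in F. False"
    by eventually_elim (use \<F> in auto)
  then show False using ultrafilter_not_bot[OF assms(2)] by simp
qed

text \<open>Without a finite subcover, the complements of the covering sets generate a proper filter
  on \<open>K\<close>, and an ultrafilter below it converges to no point of any covering
  set.\<close>

lemma compactin_ultrafilterI:
  assumes "K \<subseteq> topspace T"
    and lim: "\<And>F. ultrafilter F \<Longrightarrow> (\<forall>\<^sub>F x in F. x \<in> K) \<Longrightarrow> \<exists>l\<in>K. limitin T id l F"
  shows "compactin T K"
  unfolding compactin_def
proof (intro conjI allI impI)
  fix \<U> assume \<U>: "Ball \<U> (openin T) \<and> K \<subseteq> \<Union>\<U>"
  show "\<exists>\<F>. finite \<F> \<and> \<F> \<subseteq> \<U> \<and> K \<subseteq> \<Union>\<F>" (is ?fin)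
  proof (rule ccontr)
    assume neg: "\<not> ?fin"
    \<comment> \<open>\<open>- K\<close> joins the cover so that its complement confines the filter
      to \<open>K\<close>.\<close>
    define G where "G = (INF V\<in>insert (- K) \<U>. principal (- V))"
    have "G \<noteq> bot"
    proof
      assume "G = bot"
      then have "eventually (\<lambda>x. False) G" by simp
      from iffD1[OF eventually_INF this[unfolded G_def]] obtain X where X: "X \<subseteq> insert (- K) \<U>" "finite X" "eventually (\<lambda>x. False) (INF V\<in>X. principal (- V))"
        by blast
      then have "\<Inter>((\<lambda>V. - V) ` X) = {}"
        by (auto simp: INF_principal_finite eventually_principal)
      then have "K \<subseteq> \<Union>(X - {- K})" by auto
      moreover have "finite (X - {- K})" "X - {- K} \<subseteq> \<U>" using X by auto
      ultimately have ?fin by (intro exI[of _ "X - {- K}"] conjI)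
      with neg show False by (rule notE)
    qed
    then obtain F where F: "ultrafilter F" "F \<le> G" by (rule ultrafilter_exists)
    have ev: "\<forall>\<^sub>F x in F. x \<notin> V" if "V \<in> insert (- K) \<U>" for V
    proof -
      have "eventually (\<lambda>x. x \<notin> V) G"
        unfolding G_def
        by (rule eventually_INF1[where i = V]) (use that in \<open>simp_all add: eventually_principal\<close>)
      then show ?thesis by (rule filter_leD[OF F(2)])
    qed
    have "\<forall>\<^sub>F x in F. x \<in> K" using ev[of "- K"] by simp
    then obtain l where l: "l \<in> K" "limitin T id l F" using lim[OF F(1)] by blast
    then obtain V where V: "V \<in> \<U>" "l \<in> V" using \<U> by blast
    then have "\<forall>\<^sub>F x in F. x \<in> V" using l(2) \<U> by (auto simp: limitin_def)
    then show False
      using ultrafilter_not_eventually[OF F(1), of "\<lambda>x. x \<in> V"] ev[of V] V(1) by blast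
  qed
qed (rule assms(1))

lemma ultrafilter_Lim_eq:
  fixes f :: "'a \<Rightarrow> 'b::t2_space"
  shows "ultrafilter F \<Longrightarrow> (f \<longlongrightarrow> l) F \<Longrightarrow> Lim F f = l"
  by (simp add: tendsto_Lim ultrafilter_not_bot)

text \<open>\<open>Lim\<close> is a definite description; compactness of the closure of the range
  makes it denote a genuine limit for every bounded function.\<close>

lemma ultrafilter_tendsto_Lim:
  fixes f :: "'a \<Rightarrow> 'b::heine_borel"
  assumes "ultrafilter F" "bounded (range f)"
  shows "(f \<longlongrightarrow> Lim F f) F"
proof -
  have "compactin euclidean (closure (range f))"
    using assms(2) by (simp add: compact_closure)
  moreover have "\<forall>\<^sub>F x in F. f x \<in> closure (range f)"
    using closure_subset[of "range f"] by (intro always_eventually) auto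
  ultimately obtain l where "limitin euclidean f l F"
    by (rule compactin_ultrafilter_limit[OF _ assms(1)])
  then have "(f \<longlongrightarrow> l) F" by simp
  with ultrafilter_Lim_eq[OF assms(1) this] show ?thesis by simp
qed

lemma Lim_filtermap: "Lim (filtermap h F) f = Lim F (\<lambda>x. f (h x))"
  by (simp add: Topological_Spaces.Lim_def filterlim_filtermap)

lemma ultrafilter_norm_Lim_le:
  fixes f :: "'a \<Rightarrow> 'b::{heine_borel,real_normed_vector}"
  assumes "ultrafilter F" "\<And>x. norm (f x) \<le> B"
  shows "norm (Lim F f) \<le> B"
proof (rule tendsto_upperbound)
  show "((\<lambda>x. norm (f x)) \<longlongrightarrow> norm (Lim F f)) F"
    using assms by (intro tendsto_norm ultrafilter_tendsto_Lim) (auto simp: bounded_iff)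
qed (use assms ultrafilter_not_bot in auto)

text \<open>The hypothesis is the finite intersection property for the preimages of neighbourhoods
  of the \<open>p i\<close>. An ultrafilter on the index type thus stands in for a net of
  approximating indices.\<close>

lemma ultrafilter_simultaneous_limits:
  fixes k :: "'t \<Rightarrow> 'i \<Rightarrow> complex"
  assumes "\<And>\<Phi> e. finite \<Phi> \<Longrightarrow> \<Phi> \<subseteq> A \<Longrightarrow> 0 < e \<Longrightarrow> \<exists>t. \<forall>i\<in>\<Phi>. norm (k t i - p i) < e"
  obtains V where "ultrafilter V" "\<forall>i\<in>A. ((\<lambda>t. k t i) \<longlongrightarrow> p i) V"
proof -
  define G where "G = (INF i\<in>A. filtercomap (\<lambda>t. k t i) (nhds (p i)))"
  have "G \<noteq> bot"
  proof
    assume "G = bot"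
    then have "eventually (\<lambda>x. False) G" by simp
    from iffD1[OF eventually_INF this[unfolded G_def]] obtain X where X: "X \<subseteq> A" "finite X"
      "eventually (\<lambda>x. False) (INF i\<in>X. filtercomap (\<lambda>t. k t i) (nhds (p i)))"
      by blast
    then obtain Q where Q: "\<And>i. i \<in> X \<Longrightarrow> eventually (Q i) (filtercomap (\<lambda>t. k t i) (nhds (p i)))"
      and F: "\<And>t. \<exists>i\<in>X. \<not> Q i t"
      by (auto simp: eventually_INF_finite)
    have "\<exists>e>0. \<forall>t. norm (k t i - p i) < e \<longrightarrow> Q i t" if "i \<in> X" for i
      using Q[OF that] by (force simp: eventually_filtercomap eventually_nhds_metric dist_norm)
    then obtain e where e: "\<And>i. i \<in> X \<Longrightarrow> 0 < e i"
      "\<And>i t. i \<in> X \<Longrightarrow> norm (k t i - p i) < e i \<Longrightarrow> Q i t" by metis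
    have "0 < Min (insert 1 (e ` X))" using X e by (subst Min_gr_iff) auto
    then obtain t where t: "\<forall>i\<in>X. norm (k t i - p i) < Min (insert 1 (e ` X))"
      using assms X by blast
    have "Q i t" if "i \<in> X" for i
    proof -
      have "Min (insert 1 (e ` X)) \<le> e i" using X that by (intro Min_le) auto
      then show ?thesis using t e(2) that by (meson less_le_trans)
    qed
    then show False using F by blast
  qed
  then obtain V where V: "ultrafilter V" "V \<le> G" by (rule ultrafilter_exists)
  show thesis
  proof (rule that[OF V(1)], intro ballI)
    fix i assume "i \<in> A"
    then have "V \<le> filtercomap (\<lambda>t. k t i) (nhds (p i))"
      using V(2) unfolding G_def by (meson INF_lower order_trans)
    then show "((\<lambda>t. k t i) \<longlongrightarrow> p i) V"
      by (meson filterlim_filtercomap filterlim_mono order_refl)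
  qed
qed

text \<open>If \<open>f\<close> frequently misses a neighbourhood \<open>S\<close> along
  \<open>F\<close>, some ultrafilter below \<open>F\<close> contains the set of failures.\<close>

lemma tendsto_if_ultrafilter:
  fixes f :: "'a \<Rightarrow> 'b::topological_space"
  assumes "\<And>U. ultrafilter U \<Longrightarrow> U \<le> F \<Longrightarrow> (f \<longlongrightarrow> l) U"
  shows "(f \<longlongrightarrow> l) F"
  unfolding tendsto_def
proof (intro allI impI, rule ccontr)
  fix S assume S: "open S" "l \<in> S" "\<not> (\<forall>\<^sub>F x in F. f x \<in> S)"
  then have "inf F (principal {x. f x \<notin> S}) \<noteq> bot"
    by (auto simp: eventually_inf_principal simp flip: eventually_False)
  then obtain U where U: "ultrafilter U" "U \<le> inf F (principal {x. f x \<notin> S})"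
    by (rule ultrafilter_exists)
  then have "\<forall>\<^sub>F x in U. f x \<notin> S"
    by (auto simp: le_principal)
  moreover have "\<forall>\<^sub>F x in U. f x \<in> S"
    using assms[OF U(1)] U(2) S by (auto simp: tendsto_def)
  ultimately show False using ultrafilter_not_eventually[OF U(1)] by blast
qed

section \<open>Interchange of iterated limits\<close>

text \<open>Ultrafilters replace the sequences of the classical double limit condition: for bounded
  \<open>k\<close> all the limits written here exist.\<close>

definition double_limits_agree :: "('a \<Rightarrow> 'b \<Rightarrow> complex) \<Rightarrow> bool" where
  "double_limits_agree k \<longleftrightarrow>
     (\<forall>U V. ultrafilter U \<longrightarrow> ultrafilter V \<longrightarrow>
        Lim U (\<lambda>s. Lim V (\<lambda>t. k s t)) = Lim V (\<lambda>t. Lim U (\<lambda>s. k s t)))"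

lemma double_limits_agreeD:
  "double_limits_agree k \<Longrightarrow> ultrafilter U \<Longrightarrow> ultrafilter V \<Longrightarrow>
     Lim U (\<lambda>s. Lim V (\<lambda>t. k s t)) = Lim V (\<lambda>t. Lim U (\<lambda>s. k s t))"
  by (simp add: double_limits_agree_def)

text \<open>The limits are also located in \<open>C\<close> and \<open>D\<close>, so that the lemma
  applies to the outer limit of an iterated limit after it has been applied to the inner
  one.\<close>

lemma Lim_compose2:
  fixes a b :: "'x \<Rightarrow> complex" and h :: "complex \<Rightarrow> complex \<Rightarrow> complex"
  assumes F: "ultrafilter F" and C: "compact C" "\<And>x. a x \<in> C" and D: "compact D" "\<And>x. b x \<in> D"
    and h: "continuous_on (C \<times> D) (\<lambda>(x, y). h x y)"
  shows "Lim F a \<in> C" "Lim F b \<in> D" "Lim F (\<lambda>x. h (a x) (b x)) = h (Lim F a) (Lim F b)"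
proof -
  have "bounded (range a)"
    by (rule bounded_subset[OF compact_imp_bounded[OF C(1)]]) (auto simp: C)
  then have a: "(a \<longlongrightarrow> Lim F a) F" by (rule ultrafilter_tendsto_Lim[OF F])
  have "bounded (range b)"
    by (rule bounded_subset[OF compact_imp_bounded[OF D(1)]]) (auto simp: D)
  then have b: "(b \<longlongrightarrow> Lim F b) F" by (rule ultrafilter_tendsto_Lim[OF F])
  show aC: "Lim F a \<in> C"
    by (rule Lim_in_closed_set[OF compact_imp_closed[OF C(1)] _ ultrafilter_not_bot[OF F] a])
       (simp add: C)
  show bD: "Lim F b \<in> D"
    by (rule Lim_in_closed_set[OF compact_imp_closed[OF D(1)] _ ultrafilter_not_bot[OF F] b])
       (simp add: D)
  have "((\<lambda>x. (\<lambda>(x, y). h x y) (a x, b x)) \<longlongrightarrow> (\<lambda>(x, y). h x y) (Lim F a, Lim F b)) F"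
    by (rule continuous_on_tendsto_compose[OF h tendsto_Pair[OF a b]]) (simp_all add: aC bD C D)
  then show "Lim F (\<lambda>x. h (a x) (b x)) = h (Lim F a) (Lim F b)"
    using ultrafilter_Lim_eq[OF F] by simp
qed

text \<open>Covers sums, products, conjugates and, with \<open>C\<close> away from \<open>0\<close>, reciprocals.\<close>

lemma double_limits_agree_compose2:
  fixes k l :: "'a \<Rightarrow> 'b \<Rightarrow> complex" and h :: "complex \<Rightarrow> complex \<Rightarrow> complex"
  assumes k: "double_limits_agree k" "compact C" "\<And>s t. k s t \<in> C"
    and l: "double_limits_agree l" "compact D" "\<And>s t. l s t \<in> D"
    and h: "continuous_on (C \<times> D) (\<lambda>(x, y). h x y)"
  shows "double_limits_agree (\<lambda>s t. h (k s t) (l s t))"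
  unfolding double_limits_agree_def
proof (intro allI impI)
  fix U :: "'a filter" and V :: "'b filter" assume U: "ultrafilter U" and V: "ultrafilter V"
  note limU = Lim_compose2[OF U k(2) _ l(2) _ h] and limV = Lim_compose2[OF V k(2) _ l(2) _ h]
  have mem: "Lim V (k s) \<in> C" "Lim V (l s) \<in> D"
    "Lim U (\<lambda>s. k s t) \<in> C" "Lim U (\<lambda>s. l s t) \<in> D" for s t
    using limV(1,2)[of "k s" "l s"] limU(1,2)[of "\<lambda>s. k s t" "\<lambda>s. l s t"] k(3) l(3) by auto
  have "Lim U (\<lambda>s. Lim V (\<lambda>t. h (k s t) (l s t)))
      = h (Lim U (\<lambda>s. Lim V (\<lambda>t. k s t))) (Lim U (\<lambda>s. Lim V (\<lambda>t. l s t)))"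
    by (simp add: limU(3) limV(3) mem k(3) l(3))
  also have "\<dots> = h (Lim V (\<lambda>t. Lim U (\<lambda>s. k s t))) (Lim V (\<lambda>t. Lim U (\<lambda>s. l s t)))"
    using double_limits_agreeD[OF k(1) U V] double_limits_agreeD[OF l(1) U V] by simp
  also have "\<dots> = Lim V (\<lambda>t. Lim U (\<lambda>s. h (k s t) (l s t)))"
    by (simp add: limU(3) limV(3) mem k(3) l(3))
  finally show "Lim U (\<lambda>s. Lim V (\<lambda>t. h (k s t) (l s t))) = Lim V (\<lambda>t. Lim U (\<lambda>s. h (k s t) (l s t)))" .
qed

text \<open>Pushing \<open>U\<close> and \<open>V\<close> forward along \<open>a\<close> and
  \<open>b\<close> gives an instance of the hypothesis. This serves translations, the involution,
  and the passage to sequences.\<close>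

lemma double_limits_agree_pullback:
  fixes a :: "'a \<Rightarrow> 'c" and b :: "'b \<Rightarrow> 'd"
  assumes "double_limits_agree k"
  shows "double_limits_agree (\<lambda>s t. k (a s) (b t))"
  unfolding double_limits_agree_def
proof (intro allI impI)
  fix U :: "'a filter" and V :: "'b filter" assume "ultrafilter U" "ultrafilter V"
  then have "ultrafilter (filtermap a U)" "ultrafilter (filtermap b V)"
    by (auto intro: ultrafilter_filtermap)
  from double_limits_agreeD[OF assms this]
  show "Lim U (\<lambda>s. Lim V (\<lambda>t. k (a s) (b t))) = Lim V (\<lambda>t. Lim U (\<lambda>s. k (a s) (b t)))"
    by (simp add: Lim_filtermap)
qed

lemma double_limits_agree_swap: "double_limits_agree k \<Longrightarrow> double_limits_agree (\<lambda>s t. k t s)"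
  by (simp add: double_limits_agree_def)

lemma Lim_const_ultrafilter: "ultrafilter F \<Longrightarrow> Lim F (\<lambda>x. c :: 'b::t2_space) = c"
  by (auto intro: ultrafilter_Lim_eq)

lemma double_limits_agree_left: "double_limits_agree (\<lambda>s t. g s)"
  by (simp add: double_limits_agree_def Lim_const_ultrafilter)


section \<open>The modulus of a functional on bounded continuous functions\<close>

definition nonneg_bcont :: "('x::topological_space \<Rightarrow> real) \<Rightarrow> bool" where
  "nonneg_bcont u \<longleftrightarrow> continuous_on UNIV u \<and> (\<forall>x. 0 \<le> u x) \<and> (\<exists>B. \<forall>x. u x \<le> B)"

lemma nonneg_bcont_const: "0 \<le> c \<Longrightarrow> nonneg_bcont (\<lambda>x. c)"
  by (auto simp: nonneg_bcont_def)

lemma nonneg_bcont_add: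
  assumes "nonneg_bcont u" "nonneg_bcont v"
  shows "nonneg_bcont (\<lambda>x. u x + v x)"
proof -
  obtain B C where "\<forall>x. u x \<le> B" "\<forall>x. v x \<le> C"
    using assms by (auto simp: nonneg_bcont_def)
  then have "\<forall>x. u x + v x \<le> B + C" by (simp add: add_mono)
  then show ?thesis using assms unfolding nonneg_bcont_def
    by (intro conjI continuous_on_add) auto
qed

lemma nonneg_bcont_mult:
  assumes "nonneg_bcont u" "nonneg_bcont v"
  shows "nonneg_bcont (\<lambda>x. u x * v x)"
proof -
  obtain B C where "\<forall>x. u x \<le> B" "\<forall>x. v x \<le> C"
    using assms by (auto simp: nonneg_bcont_def)
  then have "\<forall>x. u x * v x \<le> B * C"
    using assms by (auto simp: nonneg_bcont_def intro!: mult_mono intro: order_trans)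
  then show ?thesis using assms unfolding nonneg_bcont_def
    by (intro conjI continuous_on_mult) auto
qed

text \<open>This is the lattice modulus of \<open>\<phi>\<close> on nonnegative functions; for
  \<open>\<phi>\<close> given by a measure it is integration against the total variation.\<close>

definition dual_modulus ::
    "(('x::topological_space \<Rightarrow>\<^sub>C complex) \<Rightarrow> complex) \<Rightarrow> ('x \<Rightarrow> real) \<Rightarrow> real" where
  "dual_modulus \<phi> u = (SUP g\<in>{g. \<forall>x. norm (apply_bcontfun g x) \<le> u x}. norm (\<phi> g))"

lemma cb_dual_linear:
  assumes "\<phi> \<in> cb_dual"
  shows "\<phi> (f + g) = \<phi> f + \<phi> g" "\<phi> (f - g) = \<phi> f - \<phi> g" "\<phi> 0 = 0"
    "\<phi> (r *\<^sub>R f) = r *\<^sub>R \<phi> f" "\<phi> (cb_scale c f) = c * \<phi> f"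
  using assms by (auto simp: cb_dual_def bounded_linear.linear linear_add linear_diff linear_0 linear_scale)

lemma cb_dual_bound:
  assumes "\<phi> \<in> cb_dual"
  obtains K where "0 < K" "\<forall>f. norm (\<phi> f) \<le> norm f * K"
proof -
  have "bounded_linear \<phi>" using assms by (simp add: cb_dual_def)
  from bounded_linear.pos_bounded[OF this] obtain K
    where "0 < K" "\<forall>f. norm (\<phi> f) \<le> norm f * K" by blast
  then show thesis by (rule that)
qed

lemma bcontfun_real_multiple:
  fixes g :: "'x::topological_space \<Rightarrow>\<^sub>C complex" and a :: "'x \<Rightarrow> real"
  assumes "continuous_on UNIV a" "\<And>x. \<bar>a x\<bar> \<le> B"
  obtains g' :: "'x \<Rightarrow>\<^sub>C complex" where "\<forall>x. apply_bcontfun g' x = of_real (a x) * g x"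
proof -
  have "(\<lambda>x. of_real (a x) * g x) \<in> bcontfun"
  proof (rule bcontfun_normI)
    show "continuous_on UNIV (\<lambda>x. of_real (a x) * g x)"
      using assms(1) by (intro continuous_intros) auto
    show "norm (of_real (a x) * g x) \<le> B * norm g" for x
      unfolding norm_mult using assms(2)[of x] norm_bounded[of g x] by (intro mult_mono) auto
  qed
  then show thesis using that[of "Bcontfun (\<lambda>x. of_real (a x) * g x)"] by (simp add: Bcontfun_inverse)
qed

lemma unimodular_factor:
  fixes z :: complex
  obtains c where "norm c \<le> 1" "c * z = of_real (norm z)"
proof (cases "z = 0")
  case True
  then show thesis using that[of 0] by simp
next
  case False
  have "cnj z / of_real (norm z) * z = of_real (norm z)"
    using False by (simp add: complex_norm_square[symmetric] mult.commute[of "cnj z"] power2_eq_square)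
  moreover have "norm (cnj z / of_real (norm z)) \<le> 1" using False by (simp add: norm_divide)
  ultimately show thesis by (rule that[rotated])
qed

context
  fixes \<phi> :: "('x::topological_space \<Rightarrow>\<^sub>C complex) \<Rightarrow> complex"
  assumes \<phi>: "\<phi> \<in> cb_dual"
begin

lemma dual_modulus_upper:
  assumes "nonneg_bcont u" "\<And>x. norm (apply_bcontfun g x) \<le> u x"
  shows "norm (\<phi> g) \<le> dual_modulus \<phi> u"
  unfolding dual_modulus_def
proof (rule cSUP_upper)
  obtain K where K: "0 < K" "\<forall>f. norm (\<phi> f) \<le> norm f * K" by (rule cb_dual_bound[OF \<phi>])
  obtain B where B: "\<And>x. u x \<le> B" using assms(1) by (auto simp: nonneg_bcont_def)
  have "norm (\<phi> f) \<le> B * K" if "\<forall>x. norm (apply_bcontfun f x) \<le> u x" for f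
  proof -
    have "norm f \<le> B" using that B by (intro norm_bound) (meson order_trans)
    then show ?thesis using K by (meson mult_right_mono less_imp_le order_trans)
  qed
  then show "bdd_above ((\<lambda>g. norm (\<phi> g)) ` {g. \<forall>x. norm (apply_bcontfun g x) \<le> u x})"
    by (auto intro!: bdd_aboveI)
qed (use assms in auto)

lemma dual_modulus_least:
  assumes "nonneg_bcont u" "\<And>g. (\<And>x. norm (apply_bcontfun g x) \<le> u x) \<Longrightarrow> norm (\<phi> g) \<le> c"
  shows "dual_modulus \<phi> u \<le> c"
  unfolding dual_modulus_def
proof (rule cSUP_least)
  have "0 \<in> {g. \<forall>x. norm (apply_bcontfun g x) \<le> u x}"
    using assms(1) by (auto simp: nonneg_bcont_def)
  then show "{g. \<forall>x. norm (apply_bcontfun g x) \<le> u x} \<noteq> {}" by blast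
qed (use assms(2) in auto)

lemma dual_modulus_mono:
  assumes "nonneg_bcont u" "nonneg_bcont v" "\<And>x. u x \<le> v x"
  shows "dual_modulus \<phi> u \<le> dual_modulus \<phi> v"
  by (rule dual_modulus_least[OF assms(1)], rule dual_modulus_upper[OF assms(2)])
     (meson assms(3) order_trans)

lemma dual_modulus_zero: "dual_modulus \<phi> (\<lambda>x. 0) \<le> 0"
proof (rule dual_modulus_least)
  fix g :: "'x \<Rightarrow>\<^sub>C complex" assume "\<And>x. norm (apply_bcontfun g x) \<le> 0"
  then have "g = 0" by (intro bcontfun_eqI) auto
  then show "norm (\<phi> g) \<le> 0" by (simp add: cb_dual_linear[OF \<phi>])
qed (simp add: nonneg_bcont_const)

lemma dual_modulus_scale:
  assumes "nonneg_bcont u" "0 < c"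
  shows "dual_modulus \<phi> (\<lambda>x. c * u x) \<le> c * dual_modulus \<phi> u"
proof (rule dual_modulus_least)
  show "nonneg_bcont (\<lambda>x. c * u x)"
    using assms by (intro nonneg_bcont_mult nonneg_bcont_const) auto
  fix g :: "'x \<Rightarrow>\<^sub>C complex" assume g: "\<And>x. norm (apply_bcontfun g x) \<le> c * u x"
  have "norm (\<phi> ((1 / c) *\<^sub>R g)) \<le> dual_modulus \<phi> u"
    using g assms(2) by (intro dual_modulus_upper[OF assms(1)]) (simp add: field_simps)
  then show "norm (\<phi> g) \<le> c * dual_modulus \<phi> u"
    using assms(2) by (simp add: cb_dual_linear[OF \<phi>] field_simps)
qed

text \<open>For \<open>f\<close> and \<open>g\<close> dominated by \<open>u\<close> and
  \<open>v\<close>, constants of modulus at most 1 rotate \<open>\<phi> f\<close> and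
  \<open>\<phi> g\<close> onto the nonnegative axis, where norms add, and the rotated sum is still
  dominated by \<open>u + v\<close>.\<close>

lemma dual_modulus_superadd:
  assumes "nonneg_bcont u" "nonneg_bcont v"
  shows "dual_modulus \<phi> u + dual_modulus \<phi> v \<le> dual_modulus \<phi> (\<lambda>x. u x + v x)"
proof -
  let ?s = "dual_modulus \<phi> (\<lambda>x. u x + v x)"
  have pair: "norm (\<phi> f) + norm (\<phi> g) \<le> ?s"
    if f: "\<And>x. norm (apply_bcontfun f x) \<le> u x" and g: "\<And>x. norm (apply_bcontfun g x) \<le> v x" for f g
  proof -
    obtain c where c: "norm c \<le> 1" "c * \<phi> f = of_real (norm (\<phi> f))" by (rule unimodular_factor)
    obtain d where d: "norm d \<le> 1" "d * \<phi> g = of_real (norm (\<phi> g))" by (rule unimodular_factor)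
    have "norm (\<phi> f) + norm (\<phi> g) = norm (c * \<phi> f + d * \<phi> g)"
      unfolding c(2) d(2) by (simp flip: of_real_add)
    also have "\<dots> = norm (\<phi> (cb_scale c f + cb_scale d g))"
      by (simp add: cb_dual_linear[OF \<phi>])
    also have "\<dots> \<le> ?s"
    proof (rule dual_modulus_upper[OF nonneg_bcont_add[OF assms]])
      fix x
      have "norm ((cb_scale c f + cb_scale d g) x) \<le> norm c * norm (f x) + norm d * norm (g x)"
        by (simp add: apply_cb_scale norm_triangle_le norm_mult)
      also have "\<dots> \<le> 1 * norm (f x) + 1 * norm (g x)"
        using c(1) d(1) by (intro add_mono mult_right_mono) auto
      also have "\<dots> \<le> u x + v x" using f g by (simp add: add_mono)
      finally show "norm ((cb_scale c f + cb_scale d g) x) \<le> u x + v x" .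
    qed
    finally show ?thesis .
  qed
  \<comment> \<open>The suprema over \<open>f\<close> and over \<open>g\<close> are taken one after
    the other.\<close>
  have "dual_modulus \<phi> u \<le> ?s - norm (\<phi> g)" if "\<And>x. norm (apply_bcontfun g x) \<le> v x" for g
    using pair that by (intro dual_modulus_least[OF assms(1)]) (simp add: le_diff_eq)
  then have "norm (\<phi> g) \<le> ?s - dual_modulus \<phi> u" if "\<And>x. norm (apply_bcontfun g x) \<le> v x" for g
    using that by (simp add: le_diff_eq add.commute)
  then have "dual_modulus \<phi> v \<le> ?s - dual_modulus \<phi> u"
    by (rule dual_modulus_least[OF assms(2)])
  then show ?thesis by simp
qed

text \<open>The summand \<open>\<kappa>\<close> keeps the denominator of the Riesz decomposition away from \<open>0\<close>.\<close>

lemma dual_modulus_subadd: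
  assumes u: "nonneg_bcont u" and v: "nonneg_bcont v"
  shows "dual_modulus \<phi> (\<lambda>x. u x + v x) \<le> dual_modulus \<phi> u + dual_modulus \<phi> v"
proof (rule dual_modulus_least[OF nonneg_bcont_add[OF assms]])
  fix g :: "'x \<Rightarrow>\<^sub>C complex" assume g: "\<And>x. norm (apply_bcontfun g x) \<le> u x + v x"
  obtain K where K: "0 < K" "\<forall>f. norm (\<phi> f) \<le> norm f * K" by (rule cb_dual_bound[OF \<phi>])
  show "norm (\<phi> g) \<le> dual_modulus \<phi> u + dual_modulus \<phi> v"
  proof (rule field_le_epsilon)
    fix e :: real assume e: "0 < e"
    \<comment> \<open>Chosen so that the third piece \<open>g3\<close>, bounded by
      \<open>\<kappa>\<close>, contributes at most \<open>e\<close>.\<close>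
    define \<kappa> where "\<kappa> = e / K"
    have \<kappa>: "0 < \<kappa>" using e K by (simp add: \<kappa>_def)
    define d where "d x = u x + v x + \<kappa>" for x
    have pos: "0 \<le> u x" "0 \<le> v x" "0 < d x" for x
      using u v \<kappa> by (auto simp: nonneg_bcont_def d_def add_nonneg_pos)
    have cont: "continuous_on UNIV u" "continuous_on UNIV v"
      using u v by (auto simp: nonneg_bcont_def)
    then have contd: "continuous_on UNIV d"
      unfolding d_def by (intro continuous_intros)
    \<comment> \<open>Riesz decomposition: since \<open>g\<close> is dominated by \<open>d\<close>,
      its fraction \<open>a / d\<close> is dominated by \<open>a\<close>.\<close>
    have part: "\<exists>g'. (\<forall>x. apply_bcontfun g' x = of_real (a x / d x) * g x) \<and> (\<forall>x. norm (g' x) \<le> a x)"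
      if a: "continuous_on UNIV a" "\<And>x. 0 \<le> a x" "\<And>x. a x \<le> d x" for a
    proof -
      have "continuous_on UNIV (\<lambda>x. a x / d x)"
        using a(1) contd pos(3) by (intro continuous_on_divide) (auto simp: less_imp_neq[symmetric])
      moreover have le: "\<bar>a x / d x\<bar> \<le> 1" for x
        using a pos(3)[of x] by simp
      ultimately obtain g' :: "'x \<Rightarrow>\<^sub>C complex" where g': "\<forall>x. apply_bcontfun g' x = of_real (a x / d x) * g x"
        by (rule bcontfun_real_multiple[where g = g])
      have "norm (g' x) \<le> a x" for x
      proof -
        have "norm (g' x) = a x / d x * norm (g x)"
          using a(2)[of x] pos(3)[of x] by (simp add: g' norm_mult norm_divide)
        also have "\<dots> \<le> a x / d x * d x"
          using g[of x] \<kappa> a(2)[of x] pos(3)[of x] by (intro mult_left_mono) (auto simp: d_def)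
        finally show ?thesis using pos(3)[of x] by simp
      qed
      with g' show ?thesis by blast
    qed
    have led: "u x \<le> d x" "v x \<le> d x" "\<kappa> \<le> d x" for x
      using pos[of x] \<kappa> by (auto simp: d_def)
    obtain g1 where g1: "\<forall>x. apply_bcontfun g1 x = of_real (u x / d x) * g x" "\<forall>x. norm (apply_bcontfun g1 x) \<le> u x"
      using part[OF cont(1) pos(1) led(1)] by blast
    obtain g2 where g2: "\<forall>x. apply_bcontfun g2 x = of_real (v x / d x) * g x" "\<forall>x. norm (apply_bcontfun g2 x) \<le> v x"
      using part[OF cont(2) pos(2) led(2)] by blast
    obtain g3 where g3: "\<forall>x. apply_bcontfun g3 x = of_real (\<kappa> / d x) * g x" "\<forall>x. norm (apply_bcontfun g3 x) \<le> \<kappa>"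
      using part[OF continuous_on_const less_imp_le[OF \<kappa>] led(3)] by blast
    have "g = g1 + g2 + g3"
    proof (rule bcontfun_eqI)
      fix x
      have "u x / d x + v x / d x + \<kappa> / d x = 1"
        using pos(3)[of x] by (simp add: d_def flip: add_divide_distrib)
      then have "g x = of_real (u x / d x + v x / d x + \<kappa> / d x) * g x" by simp
      then show "g x = (g1 + g2 + g3) x"
        by (simp only: plus_bcontfun.rep_eq spec[OF g1(1)] spec[OF g2(1)] spec[OF g3(1)] of_real_add distrib_right)
    qed
    then have "norm (\<phi> g) \<le> norm (\<phi> g1) + norm (\<phi> g2) + norm (\<phi> g3)"
      by (simp add: cb_dual_linear[OF \<phi>] norm_triangle_mono norm_triangle_ineq)
    moreover have "norm (\<phi> g1) \<le> dual_modulus \<phi> u" "norm (\<phi> g2) \<le> dual_modulus \<phi> v"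
      using g1 g2 u v by (auto intro: dual_modulus_upper)
    moreover have "norm (\<phi> g3) \<le> e"
    proof -
      have "norm g3 \<le> \<kappa>" using g3(2) by (simp add: norm_bound)
      then have "norm g3 * K \<le> \<kappa> * K" using K(1) by simp
      also have "\<dots> = e" using K(1) by (simp add: \<kappa>_def)
      finally show ?thesis using spec[OF K(2), of g3] by linarith
    qed
    ultimately show "norm (\<phi> g) \<le> dual_modulus \<phi> u + dual_modulus \<phi> v + e" by linarith
  qed
qed

section \<open>Weights that retain mass along an ultrafilter\<close>

text \<open>In the application \<open>u t\<close> marks where the \<open>t\<close>-th function is
  large, and \<open>w\<close> is the product of the markers chosen so far; persistence says that
  their overlap with a further marker keeps a definite mass.\<close>

definition persistent :: "'t filter \<Rightarrow> ('t \<Rightarrow> 'x \<Rightarrow> real) \<Rightarrow> ('x \<Rightarrow> real) \<Rightarrow> bool" where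
  "persistent V u w \<longleftrightarrow> (\<exists>e>0. \<forall>\<^sub>F t in V. e \<le> dual_modulus \<phi> (\<lambda>x. w x * u t x))"

text \<open>
  If multiplication by \<open>u t\<close> destroyed persistence, one could choose arbitrarily many \<open>t\<close> for which the
  functions \<open>w \<cdot> u t\<close> have modulus at least \<open>e\<close> and are pairwise almost disjoint. With \<open>S\<close> the sum
  of the \<open>u t\<close> and \<open>R\<close> the sum of their pairwise products, this contradicts the Bonferroni
  inequality \<open>S \<le> 1 + R\<close>.
\<close>

lemma persistent_mult:
  assumes V: "ultrafilter V"
    and u: "\<And>t. nonneg_bcont (u t)" "\<And>t x. u t x \<le> 1"
    and w: "nonneg_bcont w" "persistent V u w"
  shows "\<forall>\<^sub>F t in V. persistent V u (\<lambda>x. w x * u t x)"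
proof (rule ccontr)
  let ?D = "dual_modulus \<phi>"
  assume "\<not> ?thesis"
  then have nonp: "\<forall>\<^sub>F t in V. \<not> persistent V u (\<lambda>x. w x * u t x)"
    by (simp add: ultrafilter_not_eventually[OF V])
  obtain e where e: "0 < e" "\<forall>\<^sub>F t in V. e \<le> ?D (\<lambda>x. w x * u t x)"
    using w(2) by (auto simp: persistent_def)
  note nb = nonneg_bcont_add nonneg_bcont_mult u(1) w(1)
  \<comment> \<open>\<open>N\<close> counts the chosen indices. \<open>\<eta>\<close> is quantified
    so that the step can demand \<open>\<eta> / 2\<close> of its predecessor, and the last conjunct
    makes eventually every further \<open>u t\<close> almost disjoint from \<open>S\<close> under
    the weight \<open>w\<close>.\<close>
  have ex: "\<exists>S R. nonneg_bcont S \<and> nonneg_bcont R \<and> (\<forall>x. S x \<le> 1 + R x) \<and>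
      real N * e \<le> ?D (\<lambda>x. w x * S x) \<and> ?D (\<lambda>x. w x * R x) \<le> \<eta> \<and>
      (\<forall>\<eta>>0. \<forall>\<^sub>F t in V. ?D (\<lambda>x. w x * S x * u t x) < \<eta>)" if "0 < \<eta>" for N \<eta>
    using that
  proof (induction N arbitrary: \<eta>)
    case 0
    have "0 \<le> ?D (\<lambda>x. 0)"
      using dual_modulus_upper[OF nonneg_bcont_const[of 0], of 0] by (simp add: cb_dual_linear[OF \<phi>])
    with dual_modulus_zero 0 show ?case
      by (intro exI[of _ "\<lambda>x. 0"] conjI) (auto simp: nonneg_bcont_const)
  next
    case (Suc N)
    obtain S R where SR: "nonneg_bcont S" "nonneg_bcont R" "\<And>x. S x \<le> 1 + R x"
      "real N * e \<le> ?D (\<lambda>x. w x * S x)" "?D (\<lambda>x. w x * R x) \<le> \<eta> / 2"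
      "\<And>\<eta>. 0 < \<eta> \<Longrightarrow> \<forall>\<^sub>F t in V. ?D (\<lambda>x. w x * S x * u t x) < \<eta>"
      using Suc.IH[of "\<eta> / 2"] Suc.prems by auto
    have "0 < \<eta> / 2" using Suc.prems by simp
    from eventually_conj[OF nonp eventually_conj[OF e(2) SR(6)[OF this]]]
    obtain t where t: "\<not> persistent V u (\<lambda>x. w x * u t x)" "e \<le> ?D (\<lambda>x. w x * u t x)"
      "?D (\<lambda>x. w x * S x * u t x) < \<eta> / 2"
      using eventually_happens[of _ V] ultrafilter_not_bot[OF V] by blast
    define S' where "S' = (\<lambda>x. S x + u t x)"
    define R' where "R' = (\<lambda>x. R x + S x * u t x)"
    have nS: "nonneg_bcont S'" and nR: "nonneg_bcont R'"
      unfolding S'_def R'_def by (intro nb SR)+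
    \<comment> \<open>Where \<open>S\<close> is at least 1, the new product absorbs
      \<open>u t\<close>; elsewhere the inequality is \<open>(1 - S x) * (1 - u t x) \<ge> 0\<close>
      combined with \<open>R x \<ge> 0\<close>.\<close>
    have "S' x \<le> 1 + R' x" for x
    proof (cases "1 \<le> S x")
      case True
      then have "1 * u t x \<le> S x * u t x"
        using u(1)[of t] by (intro mult_right_mono) (auto simp: nonneg_bcont_def)
      then show ?thesis using SR(3)[of x] by (simp add: S'_def R'_def)
    next
      case False
      then have "0 \<le> (1 - S x) * (1 - u t x)" using u(2)[of t x] by simp
      moreover have "0 \<le> R x" using SR(2) by (simp add: nonneg_bcont_def)
      ultimately show ?thesis by (simp add: S'_def R'_def algebra_simps)
    qed
    moreover have "real (Suc N) * e \<le> ?D (\<lambda>x. w x * S' x)"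
    proof -
      have "?D (\<lambda>x. w x * S x) + ?D (\<lambda>x. w x * u t x) \<le> ?D (\<lambda>x. w x * S x + w x * u t x)"
        by (intro dual_modulus_superadd nb SR)
      then show ?thesis using SR(4) t(2) by (simp add: S'_def algebra_simps)
    qed
    moreover have "?D (\<lambda>x. w x * R' x) \<le> \<eta>"
    proof -
      have "?D (\<lambda>x. w x * R x + w x * S x * u t x) \<le> ?D (\<lambda>x. w x * R x) + ?D (\<lambda>x. w x * S x * u t x)"
        by (intro dual_modulus_subadd nb SR)
      then show ?thesis using SR(5) t(3) by (simp add: R'_def algebra_simps)
    qed
    moreover have "\<forall>\<^sub>F t' in V. ?D (\<lambda>x. w x * S' x * u t' x) < \<theta>" if "0 < \<theta>" for \<theta>
    proof -
      have "\<not> (\<forall>\<^sub>F t' in V. \<theta> / 2 \<le> ?D (\<lambda>x. w x * u t x * u t' x))"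
        using t(1) that unfolding persistent_def by (metis half_gt_zero)
      then have "\<forall>\<^sub>F t' in V. \<not> \<theta> / 2 \<le> ?D (\<lambda>x. w x * u t x * u t' x)"
        by (simp only: ultrafilter_not_eventually[OF V])
      moreover have "\<forall>\<^sub>F t' in V. ?D (\<lambda>x. w x * S x * u t' x) < \<theta> / 2"
        using that by (intro SR(6)) simp
      ultimately show ?thesis
      proof eventually_elim
        case (elim t')
        have "?D (\<lambda>x. w x * S x * u t' x + w x * u t x * u t' x)
            \<le> ?D (\<lambda>x. w x * S x * u t' x) + ?D (\<lambda>x. w x * u t x * u t' x)"
          by (intro dual_modulus_subadd nb SR)
        then show ?case using elim by (simp add: S'_def algebra_simps)
      qed
    qed
    ultimately show ?case using nS nR by blast
  qed
  \<comment> \<open>For such \<open>N\<close> the lower bound \<open>N * e\<close> for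
    \<open>w * S\<close> exceeds the upper bound that \<open>S \<le> 1 + R\<close> provides, with
    \<open>R\<close> of mass at most 1.\<close>
  obtain N where N: "?D w + 1 < real N * e"
    using reals_Archimedean3[OF e(1)] by blast
  obtain S R where SR: "nonneg_bcont S" "nonneg_bcont R" "\<And>x. S x \<le> 1 + R x"
      "real N * e \<le> ?D (\<lambda>x. w x * S x)" "?D (\<lambda>x. w x * R x) \<le> 1"
    using ex[of 1 N] by auto
  have "?D (\<lambda>x. w x * S x) \<le> ?D (\<lambda>x. w x + w x * R x)"
  proof (intro dual_modulus_mono nb SR)
    fix x
    have "w x * S x \<le> w x * (1 + R x)"
      using SR(3)[of x] w(1) by (intro mult_left_mono) (auto simp: nonneg_bcont_def)
    then show "w x * S x \<le> w x + w x * R x" by (simp add: algebra_simps)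
  qed
  also have "\<dots> \<le> ?D w + ?D (\<lambda>x. w x * R x)"
    by (intro dual_modulus_subadd nb SR)
  finally show False using N SR by linarith
qed

text \<open>A weight vanishing everywhere has no mass. This supplies the points where finitely many
  markers are positive at once.\<close>

lemma persistent_positive:
  assumes V: "ultrafilter V" and w: "nonneg_bcont w" "persistent V u w"
  obtains x where "0 < w x"
proof (rule ccontr)
  assume "\<not> thesis"
  then have "\<not> 0 < w x" for x using that by blast
  then have "w x = 0" for x using w(1) by (auto simp: nonneg_bcont_def less_le)
  then obtain e where "0 < e" "\<forall>\<^sub>F t in V. e \<le> dual_modulus \<phi> (\<lambda>x. 0)"
    using w(2) by (auto simp: persistent_def)
  then show False
    using dual_modulus_zero ultrafilter_not_bot[OF V] by (auto simp: eventually_const)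
qed

text \<open>
  The indices \<open>t i\<close> are chosen so that finite products of the truncations \<open>max 0 (\<bar>h (t i)\<bar> - \<delta>)\<close> stay
  persistent, and \<open>x m\<close> is a point at which the first \<open>m + 1\<close> factors are positive.
\<close>

lemma not_weakly_null_sequence:
  fixes h :: "'t \<Rightarrow> 'x \<Rightarrow>\<^sub>C complex"
  assumes V: "ultrafilter V" and bound: "\<And>t. norm (h t) \<le> C"
    and null: "\<And>x. ((\<lambda>t. h t x) \<longlongrightarrow> 0) V" and not_null: "\<not> ((\<lambda>t. \<phi> (h t)) \<longlongrightarrow> 0) V"
  obtains \<delta> t x where "0 < \<delta>" "\<forall>m. \<forall>i\<le>m. \<delta> \<le> norm (h (t i) (x m))"
    "\<forall>m. \<forall>k<m. norm (h (t m) (x k)) < inverse (real (Suc m))"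
proof -
  let ?D = "dual_modulus \<phi>"
  obtain K where K: "0 < K" "\<forall>f. norm (\<phi> f) \<le> norm f * K" by (rule cb_dual_bound[OF \<phi>])
  obtain e where e: "0 < e" "\<not> (\<forall>\<^sub>F t in V. norm (\<phi> (h t)) < e)"
    using not_null by (auto simp: tendsto_iff)
  have ev: "\<forall>\<^sub>F t in V. e \<le> norm (\<phi> (h t))"
    using e(2) unfolding ultrafilter_not_eventually[OF V] by (simp add: not_less)
  \<comment> \<open>The maximum with 1 makes the divisor in \<open>u\<close> positive even when
    \<open>C\<close> is 0.\<close>
  define B where "B = max C 1"
  have B: "0 < B" "norm (h t x) \<le> B" for t x
    using norm_bounded[of "h t" x] bound[of t] by (auto simp: B_def)
  \<comment> \<open>The constant function \<open>\<delta>\<close> then has modulus at most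
    \<open>e / 2\<close>, leaving half of \<open>e\<close> to the truncations.\<close>
  define \<delta> where "\<delta> = e / (2 * K)"
  have \<delta>: "0 < \<delta>" using e K by (simp add: \<delta>_def)
  define u where "u t x = max 0 (norm (h t x) - \<delta>) / B" for t x
  have u: "nonneg_bcont (u t)" "u t x \<le> 1" for t x
  proof -
    show le: "u t x \<le> 1" for x using B(1) B(2)[of t x] \<delta> by (simp add: u_def)
    have "continuous_on UNIV (u t)"
      unfolding u_def by (intro continuous_intros) (use B in auto)
    moreover have "0 \<le> u t x" for x using B(1) by (simp add: u_def)
    ultimately show "nonneg_bcont (u t)" using le by (auto simp: nonneg_bcont_def)
  qed
  \<comment> \<open>Since \<open>norm (h t x) \<le> B * u t x + \<delta>\<close>, subadditivity
    bounds \<open>norm (\<phi> (h t))\<close> by \<open>B\<close> times the modulus of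
    \<open>u t\<close> plus \<open>e / 2\<close>.\<close>
  have "persistent V u (\<lambda>x. 1)"
    unfolding persistent_def
  proof (intro exI conjI)
    show "0 < e / (2 * B)" using e B by simp
    show "\<forall>\<^sub>F t in V. e / (2 * B) \<le> ?D (\<lambda>x. 1 * u t x)"
      using ev
    proof eventually_elim
      case (elim t)
      have nu: "nonneg_bcont (\<lambda>x. B * u t x)"
        using B u by (intro nonneg_bcont_mult nonneg_bcont_const) auto
      have "norm (\<phi> (h t)) \<le> ?D (\<lambda>x. B * u t x + \<delta>)"
      proof (rule dual_modulus_upper)
        show "nonneg_bcont (\<lambda>x. B * u t x + \<delta>)"
          using nu \<delta> by (intro nonneg_bcont_add nonneg_bcont_const) auto
        show "norm (h t x) \<le> B * u t x + \<delta>" for x using B(1) by (simp add: u_def)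
      qed
      also have "\<dots> \<le> ?D (\<lambda>x. B * u t x) + ?D (\<lambda>x. \<delta>)"
        using nu \<delta> by (intro dual_modulus_subadd nonneg_bcont_const) auto
      also have "?D (\<lambda>x. B * u t x) \<le> B * ?D (u t)"
        using u B by (intro dual_modulus_scale) auto
      also have "?D (\<lambda>x. \<delta>) \<le> e / 2"
      proof (rule dual_modulus_least)
        show "nonneg_bcont (\<lambda>x::'x. \<delta>)" using \<delta> by (intro nonneg_bcont_const) simp
        fix g :: "'x \<Rightarrow>\<^sub>C complex" assume "\<And>x. norm (apply_bcontfun g x) \<le> \<delta>"
        then have "norm g * K \<le> \<delta> * K" using K(1) by (simp add: norm_bound)
        also have "\<dots> = e / 2" using K(1) by (simp add: \<delta>_def)
        finally show "norm (\<phi> g) \<le> e / 2" using spec[OF K(2), of g] by linarith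
      qed
      finally show ?case using elim B(1) by (simp add: field_simps)
    qed
  qed
  then have one: "nonneg_bcont (\<lambda>x::'x. 1)" "persistent V u (\<lambda>x. 1)"
    by (auto simp: nonneg_bcont_const)
  \<comment> \<open>A state holds the current product \<open>w\<close>, the finite set
    \<open>D\<close> of points chosen so far, and the latest index and point.\<close>
  define P where "P = (\<lambda>(n::nat) (w, D, t::'t, x). nonneg_bcont w \<and> persistent V u w \<and>
     finite D \<and> x \<in> D \<and> 0 < w (x::'x))"
  define Q where "Q = (\<lambda>n (w, D, t::'t, x::'x) (w', D', t', x').
     w' = (\<lambda>x. w x * u t' x) \<and> D' = insert x' D \<and>
     (\<forall>d\<in>D. norm (h t' d) < inverse (real (Suc n))))"
  \<comment> \<open>The initial index and point are dummies; the sequences \<open>t\<close> and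
    \<open>x\<close> below read their \<open>n\<close>-th terms from stage
    \<open>Suc n\<close>.\<close>
  have start: "\<exists>z. P 0 z"
    using one unfolding P_def by (intro exI[of _ "(\<lambda>x. 1, {undefined}, undefined, undefined)"]) simp
  have step: "\<exists>z'. P (Suc n) z' \<and> Q n z z'" if Pz: "P n z" for n z
  proof -
    obtain w D t x where z: "z = (w, D, t, x)" by (cases z)
    have w: "nonneg_bcont w" "persistent V u w" "finite D" using Pz by (auto simp: P_def z)
    have "\<forall>\<^sub>F t in V. \<forall>d\<in>D. norm (h t d) < inverse (real (Suc n))"
      using w(3) by (rule eventually_ball_finite) (use null in \<open>auto simp: tendsto_iff\<close>)
    from eventually_conj[OF this persistent_mult[OF V u w(1,2)]]
    obtain t' where t': "\<forall>d\<in>D. norm (h t' d) < inverse (real (Suc n))"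
      "persistent V u (\<lambda>x. w x * u t' x)"
      using eventually_happens[of _ V] ultrafilter_not_bot[OF V] by blast
    have nw: "nonneg_bcont (\<lambda>x. w x * u t' x)" by (intro nonneg_bcont_mult w u)
    obtain x' where x': "0 < w x' * u t' x'"
      using persistent_positive[OF V nw t'(2)] by blast
    show ?thesis
      using w t' nw x' unfolding P_def Q_def z
      by (intro exI[of _ "(\<lambda>x. w x * u t' x, insert x' D, t', x')"]) auto
  qed
  obtain Z where Z: "\<And>n. P n (Z n)" "\<And>n. Q n (Z n) (Z (Suc n))"
    using dependent_nat_choice[of P Q] start step by metis
  define w where "w n = fst (Z n)" for n
  define D where "D n = fst (snd (Z n))" for n
  define t where "t n = fst (snd (snd (Z (Suc n))))" for n
  define x where "x n = snd (snd (snd (Z (Suc n))))" for n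
  have PZ: "nonneg_bcont (w n)" "0 < w (Suc n) (x n)" "x n \<in> D (Suc n)" for n
    using Z(1)[of n] Z(1)[of "Suc n"] by (auto simp: P_def w_def D_def x_def split: prod.splits)
  have QZ: "w (Suc n) = (\<lambda>x. w n x * u (t n) x)" "D n \<subseteq> D (Suc n)"
    "\<forall>d\<in>D n. norm (h (t n) d) < inverse (real (Suc n))" for n
    using Z(2)[of n] by (auto simp: Q_def w_def D_def t_def split: prod.splits)
  have pos: "0 < u (t i) y" if "0 < w (Suc m) y" "i \<le> m" for i m y
    using that
  proof (induction m)
    case 0
    then show ?case using PZ(1)[of 0] u(1)[of "t 0"]
      by (auto simp: QZ nonneg_bcont_def zero_less_mult_iff less_le)
  next
    case (Suc m)
    have "0 < w (Suc m) y * u (t (Suc m)) y" using Suc.prems by (simp add: QZ(1)[of "Suc m"])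
    moreover have "0 \<le> w (Suc m) y" "0 \<le> u (t (Suc m)) y"
      using PZ(1)[of "Suc m"] u(1)[of "t (Suc m)"] by (auto simp: nonneg_bcont_def)
    ultimately have "0 < w (Suc m) y" "0 < u (t (Suc m)) y"
      by (auto simp: zero_less_mult_iff)
    then show ?case using Suc by (cases "i = Suc m") auto
  qed
  show thesis
  proof (rule that[OF \<delta>], intro allI impI)
    fix m i :: nat assume "i \<le> m"
    then have "0 < u (t i) (x m)" using pos PZ(2) by blast
    then show "\<delta> \<le> norm (h (t i) (x m))" using B(1) by (auto simp: u_def zero_less_divide_iff max_def split: if_splits)
  next
    \<comment> \<open>For \<open>k < m\<close> the point \<open>x k\<close> lies in
      \<open>D (Suc k)\<close>, hence in \<open>D m\<close>, where \<open>h (t m)\<close> was made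
      small.\<close>
    have "D n \<subseteq> D m" if "n \<le> m" for n m
      using that QZ(2) by (rule lift_Suc_mono_le[rotated])
    then show "\<forall>m. \<forall>k<m. norm (h (t m) (x k)) < inverse (real (Suc m))"
      using PZ(3) QZ(3) by (meson Suc_leI subsetD)
  qed
qed

end


section \<open>The double limit criterion for weak compactness\<close>

text \<open>Testing weak convergence on this functional is what moves a limit along \<open>V\<close>
  past a limit along \<open>U\<close>.\<close>

lemma ultrafilter_functional_in_cb_dual:
  fixes U :: "'x::topological_space filter"
  assumes U: "ultrafilter U"
  shows "(\<lambda>f. Lim U (apply_bcontfun f)) \<in> cb_dual"
proof -
  have lim: "((\<lambda>x. apply_bcontfun f x) \<longlongrightarrow> Lim U f) U" for f :: "'x \<Rightarrow>\<^sub>C complex"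
    by (intro ultrafilter_tendsto_Lim[OF U] bounded_apply_bcontfun)
  have "bounded_linear (\<lambda>f. Lim U (apply_bcontfun f) :: complex)"
  proof (rule bounded_linear_intro[where K = 1])
    fix f g :: "'x \<Rightarrow>\<^sub>C complex" and r :: real
    show "Lim U (apply_bcontfun (f + g)) = Lim U f + Lim U g"
      using tendsto_add[OF lim lim, of f g] by (intro ultrafilter_Lim_eq[OF U]) simp
    show "Lim U (apply_bcontfun (r *\<^sub>R f)) = r *\<^sub>R Lim U f"
      using tendsto_scaleR[OF tendsto_const lim, of r f] by (intro ultrafilter_Lim_eq[OF U]) simp
    show "norm (Lim U f) \<le> norm f * 1"
      using ultrafilter_norm_Lim_le[OF U, of f] norm_bounded[of f] by simp
  qed
  moreover have "Lim U (apply_bcontfun (cb_scale c f)) = c * Lim U f" for c f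
    using tendsto_mult[OF tendsto_const lim, of c f]
    by (intro ultrafilter_Lim_eq[OF U]) (simp flip: apply_cb_scale)
  ultimately show ?thesis by (simp add: cb_dual_def)
qed

lemma point_evaluation_in_cb_dual: "(\<lambda>f. apply_bcontfun f x) \<in> cb_dual"
proof -
  have "bounded_linear (\<lambda>f. apply_bcontfun f x :: complex)"
    by (rule bounded_linear_intro[where K = 1]) (auto simp: norm_bounded)
  then show ?thesis by (simp add: cb_dual_def apply_cb_scale)
qed

lemma topspace_cb_weak_topology [simp]: "topspace cb_weak_topology = UNIV"
  unfolding cb_weak_topology_def topology_generated_by_topspace
  using point_evaluation_in_cb_dual by blast

lemma continuous_map_cb_dual:
  assumes "\<phi> \<in> cb_dual"
  shows "continuous_map cb_weak_topology euclidean \<phi>"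
  unfolding continuous_map
proof (intro conjI allI impI)
  fix U :: "complex set" assume "openin euclidean U"
  then have "openin cb_weak_topology (\<phi> -` U)"
    unfolding cb_weak_topology_def using assms by (intro topology_generated_by_Basis) auto
  then show "openin cb_weak_topology {f \<in> topspace cb_weak_topology. \<phi> f \<in> U}"
    by (simp add: vimage_def)
qed auto

lemma limitin_cb_weakI:
  assumes "\<And>\<phi>. \<phi> \<in> cb_dual \<Longrightarrow> ((\<lambda>t. \<phi> (k t)) \<longlongrightarrow> \<phi> l) F"
  shows "limitin cb_weak_topology k l F"
  unfolding limitin_def
proof (intro conjI allI impI)
  fix U assume "openin cb_weak_topology U \<and> l \<in> U"
  then have "generate_topology_on {\<phi> -` U | \<phi> U. \<phi> \<in> cb_dual \<and> open U} U" "l \<in> U"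
    by (auto simp: cb_weak_topology_def openin_topology_generated_by_iff)
  then show "\<forall>\<^sub>F t in F. k t \<in> U"
  proof (induction rule: generate_topology_on.induct)
    case (Int a b)
    then show ?case by (auto simp: eventually_conj_iff)
  next
    case (UN K)
    then obtain A where A: "A \<in> K" "l \<in> A" by blast
    with UN have "\<forall>\<^sub>F t in F. k t \<in> A" by blast
    then show ?case using A by (auto elim: eventually_mono)
  next
    case (Basis s)
    then obtain \<phi> V where s: "s = \<phi> -` V" "\<phi> \<in> cb_dual" "open V" by blast
    then show ?case
      using topological_tendstoD[OF assms[of \<phi>], of V] Basis by simp
  qed simp
qed simp

lemma limitin_cb_weakD:
  assumes "limitin cb_weak_topology k l F" "\<phi> \<in> cb_dual"
  shows "((\<lambda>t. \<phi> (k t)) \<longlongrightarrow> \<phi> l) F"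
  using continuous_map_limit[OF continuous_map_cb_dual[OF assms(2)] assms(1)] by (simp add: o_def)

text \<open>The candidate is the pointwise limit, continuous by interchange. If the differences from
  it were not weakly null, \<open>not_weakly_null_sequence\<close> would produce an array with one
  iterated limit 0 and the other of norm at least \<open>\<delta>\<close>.\<close>

lemma double_limits_agree_weak_limit:
  fixes k :: "'t \<Rightarrow> 'x::topological_space \<Rightarrow>\<^sub>C complex"
  assumes bound: "\<And>t. norm (k t) \<le> M" and dl: "double_limits_agree (\<lambda>x t. k t x)"
    and V: "ultrafilter V"
  obtains g :: "'x \<Rightarrow>\<^sub>C complex" where "limitin cb_weak_topology k g V"
proof -
  have kM: "norm (k t x) \<le> M" for t x
    using norm_bounded[of "k t" x] bound[of t] by simp
  define g0 where "g0 x = Lim V (\<lambda>t. k t x)" for x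
  have lim0: "((\<lambda>t. k t x) \<longlongrightarrow> g0 x) V" for x
    unfolding g0_def using kM by (intro ultrafilter_tendsto_Lim[OF V]) (auto simp: bounded_iff)
  have gM: "norm (g0 x) \<le> M" for x
    unfolding g0_def using kM by (intro ultrafilter_norm_Lim_le[OF V])
  \<comment> \<open>Along an ultrafilter below \<open>at x\<close>, interchange moves the limit
    inside, where each \<open>k t\<close> is continuous.\<close>
  have "(g0 \<longlongrightarrow> g0 x) (at x)" for x
  proof (rule tendsto_if_ultrafilter)
    fix U assume U: "ultrafilter U" "U \<le> at x"
    have "Lim U (apply_bcontfun (k t)) = k t x" for t
    proof (rule ultrafilter_Lim_eq[OF U(1)])
      have "(apply_bcontfun (k t) \<longlongrightarrow> k t x) (at x)"
        using continuous_on_apply_bcontfun[of UNIV "k t"] by (simp add: continuous_on_def)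
      then show "(apply_bcontfun (k t) \<longlongrightarrow> k t x) U" using U(2) by (rule tendsto_mono[rotated])
    qed
    then have "Lim U g0 = g0 x"
      using double_limits_agreeD[OF dl U(1) V] by (simp flip: g0_def)
    then show "(g0 \<longlongrightarrow> g0 x) U"
      using ultrafilter_tendsto_Lim[OF U(1), of g0] gM by (auto simp: bounded_iff)
  qed
  then have "g0 \<in> bcontfun" using gM by (intro bcontfun_normI) (auto simp: continuous_on_def)
  then obtain g where g: "g0 = apply_bcontfun g" by (rule bcontfunE)
  define h where "h t = k t - g" for t
  have hx: "h t x = k t x - g x" for t x by (simp add: h_def)
  have hM: "norm (h t) \<le> M + norm g" for t
    unfolding h_def using bound[of t] norm_triangle_ineq4[of "k t" g] by linarith
  have null: "((\<lambda>t. h t x) \<longlongrightarrow> 0) V" for x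
    using tendsto_diff[OF lim0[of x] tendsto_const[of "g0 x"]] by (simp add: hx g)
  have dlh: "double_limits_agree (\<lambda>x t. h t x)"
    unfolding hx
    by (rule double_limits_agree_compose2[OF dl _ _ double_limits_agree_left,
          of "cball 0 M" "cball 0 (norm g)" "\<lambda>x. g x" "\<lambda>x y. x - y"])
       (auto simp: kM norm_bounded case_prod_unfold intro!: continuous_intros)
  have "((\<lambda>t. \<phi> (h t)) \<longlongrightarrow> 0) V" if \<phi>: "\<phi> \<in> cb_dual" for \<phi>
  proof (rule ccontr)
    assume "\<not> ?thesis"
    from not_weakly_null_sequence[OF \<phi> V hM null this] obtain \<delta> t x where \<delta>: "0 < \<delta>"
      and low: "\<forall>m. \<forall>i\<le>m. \<delta> \<le> norm (h (t i) (x m))"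
      and small: "\<forall>m. \<forall>k<m. norm (h (t m) (x k)) < inverse (real (Suc m))" .
    \<comment> \<open>One free ultrafilter serves both indices: for fixed \<open>m\<close> the
      entries tend to 0 as \<open>i\<close> grows, whereas for fixed \<open>i\<close> they have norm
      at least \<open>\<delta>\<close> once \<open>m \<ge> i\<close>.\<close>
    obtain W :: "nat filter" where W: "ultrafilter W" "W \<le> sequentially"
      by (rule ultrafilter_exists[OF sequentially_bot])
    have hb: "norm (h a b) \<le> M + norm g" for a b
      using norm_bounded[of "h a" b] hM[of a] by simp
    have "Lim W (\<lambda>i. h (t i) (x m)) = 0" for m
    proof (rule ultrafilter_Lim_eq[OF W(1)], rule tendsto_mono[OF W(2)], rule Lim_null_comparison)
      show "\<forall>\<^sub>F i in sequentially. norm (h (t i) (x m)) \<le> inverse (real (Suc i))"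
        using eventually_gt_at_top[of m] by eventually_elim (use small in \<open>auto intro: less_imp_le\<close>)
    qed (rule LIMSEQ_inverse_real_of_nat)
    then have "Lim W (\<lambda>i. Lim W (\<lambda>m. h (t i) (x m))) = 0"
      using double_limits_agreeD[OF double_limits_agree_pullback[OF dlh, where a = x and b = t] W(1) W(1)]
      by (simp add: Lim_const_ultrafilter[OF W(1)])
    moreover
    have norm_low: "\<delta> \<le> norm (Lim W (a :: nat \<Rightarrow> complex))"
      if "\<And>i. norm (a i) \<le> M + norm g" "\<forall>\<^sub>F i in W. \<delta> \<le> norm (a i)" for a
    proof (rule tendsto_lowerbound[OF _ that(2) ultrafilter_not_bot[OF W(1)]])
      show "((\<lambda>i. norm (a i)) \<longlongrightarrow> norm (Lim W a)) W"
        using that(1) by (intro tendsto_norm ultrafilter_tendsto_Lim[OF W(1)]) (auto simp: bounded_iff)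
    qed
    have "\<forall>\<^sub>F m in W. \<delta> \<le> norm (h (t i) (x m))" for i
      using filter_leD[OF W(2) eventually_ge_at_top[of i]] by eventually_elim (use low in auto)
    then have "\<delta> \<le> norm (Lim W (\<lambda>m. h (t i) (x m)))" for i
      by (intro norm_low hb)
    then have "\<delta> \<le> norm (Lim W (\<lambda>i. Lim W (\<lambda>m. h (t i) (x m))))"
      by (intro norm_low ultrafilter_norm_Lim_le[OF W(1) hb]) simp
    ultimately show False using \<delta> by simp
  qed
  then have "((\<lambda>t. \<phi> (k t)) \<longlongrightarrow> \<phi> g) V" if "\<phi> \<in> cb_dual" for \<phi>
    using that unfolding h_def by (subst LIM_zero_iff[symmetric]) (simp add: cb_dual_linear)
  then show thesis by (intro that[of g] limitin_cb_weakI)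
qed

text \<open>Given compactness, \<open>k\<close> has a weak limit \<open>g\<close> along
  \<open>V\<close>, and both iterated limits equal \<open>Lim U g\<close>. Conversely, an
  ultrafilter on the closure is traced by one on the indices, along which \<open>k\<close> converges
  weakly.\<close>

theorem grothendieck_double_limit_criterion:
  fixes k :: "'t \<Rightarrow> 'x::topological_space \<Rightarrow>\<^sub>C complex"
  assumes bound: "\<And>t. norm (k t) \<le> M"
  shows "compactin cb_weak_topology (cb_weak_topology closure_of range k)
     \<longleftrightarrow> double_limits_agree (\<lambda>x t. k t x)"
proof
  let ?W = "cb_weak_topology :: ('x \<Rightarrow>\<^sub>C complex) topology"
  let ?K = "?W closure_of range k"
  have kK: "k t \<in> ?K" for t
    using closure_of_subset[of "range k" ?W] by auto
  {
    assume comp: "compactin ?W ?K"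
    show "double_limits_agree (\<lambda>x t. k t x)"
      unfolding double_limits_agree_def
    proof (intro allI impI)
      fix U :: "'x filter" and V :: "'t filter" assume U: "ultrafilter U" and V: "ultrafilter V"
      have "\<forall>\<^sub>F t in V. k t \<in> ?K" by (simp add: kK)
      then obtain g where g: "limitin ?W k g V"
        by (rule compactin_ultrafilter_limit[OF comp V])
      have "Lim V (\<lambda>t. k t x) = g x" for x
        using limitin_cb_weakD[OF g point_evaluation_in_cb_dual] by (rule ultrafilter_Lim_eq[OF V])
      moreover have "Lim V (\<lambda>t. Lim U (k t)) = Lim U g"
        using limitin_cb_weakD[OF g ultrafilter_functional_in_cb_dual[OF U]]
        by (rule ultrafilter_Lim_eq[OF V])
      ultimately show "Lim U (\<lambda>x. Lim V (\<lambda>t. k t x)) = Lim V (\<lambda>t. Lim U (\<lambda>x. k t x))"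
        by simp
    qed
  next
    assume dl: "double_limits_agree (\<lambda>x t. k t x)"
    show "compactin ?W ?K"
    proof (rule compactin_ultrafilterI)
      fix F assume F: "ultrafilter F" "\<forall>\<^sub>F f in F. f \<in> ?K"
      \<comment> \<open>The bound \<open>M * C\<close> on the values of \<open>\<phi>\<close> is a
        weakly closed condition, so it extends from the range of \<open>k\<close> to the
        closure.\<close>
      have "\<exists>p. (\<phi> \<longlongrightarrow> p) F" if \<phi>: "\<phi> \<in> cb_dual" for \<phi>
      proof -
        obtain C where C: "0 < C" "\<forall>f. norm (\<phi> f) \<le> norm f * C" by (rule cb_dual_bound[OF \<phi>])
        have "closedin ?W {f \<in> topspace ?W. \<phi> f \<in> cball 0 (M * C)}"
          by (rule closedin_continuous_map_preimage[OF continuous_map_cb_dual[OF \<phi>]]) simp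
        moreover have "norm (\<phi> (k t)) \<le> M * C" for t
          using C bound[of t] by (meson mult_right_mono less_imp_le order_trans)
        ultimately have "?K \<subseteq> {f. \<phi> f \<in> cball 0 (M * C)}"
          by (intro closure_of_minimal) auto
        then have ev: "\<forall>\<^sub>F f in F. \<phi> f \<in> cball 0 (M * C)"
          using F(2) by (auto elim: eventually_mono)
        have "compactin euclidean (cball (0::complex) (M * C))" by simp
        then obtain p where "limitin euclidean \<phi> p F"
          by (rule compactin_ultrafilter_limit[OF _ F(1) ev])
        then show ?thesis by auto
      qed
      then obtain p where p: "\<And>\<phi>. \<phi> \<in> cb_dual \<Longrightarrow> (\<phi> \<longlongrightarrow> p \<phi>) F" by metis
      \<comment> \<open>Each closure point is approximated on finitely many functionals by some
        \<open>k t\<close>; hence an ultrafilter of indices has the same limits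
        \<open>p \<phi>\<close> as \<open>F\<close>.\<close>
      obtain V where V: "ultrafilter V" "\<forall>\<phi>\<in>cb_dual. ((\<lambda>t. \<phi> (k t)) \<longlongrightarrow> p \<phi>) V"
      proof (rule ultrafilter_simultaneous_limits[of cb_dual "\<lambda>t \<phi>. \<phi> (k t)" p])
        fix \<Phi> :: "(('x \<Rightarrow>\<^sub>C complex) \<Rightarrow> complex) set" and e :: real
        assume \<Phi>: "finite \<Phi>" "\<Phi> \<subseteq> cb_dual" "0 < e"
        have "\<forall>\<^sub>F f in F. \<forall>\<phi>\<in>\<Phi>. dist (\<phi> f) (p \<phi>) < e / 2"
          using \<Phi> by (intro eventually_ball_finite ballI tendstoD[OF p]) auto
        from eventually_conj[OF this F(2)]
        obtain f where f: "\<forall>\<phi>\<in>\<Phi>. dist (\<phi> f) (p \<phi>) < e / 2" "f \<in> ?K"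
          using eventually_happens[of _ F] ultrafilter_not_bot[OF F(1)] by blast
        have "openin ?W (\<Inter>\<phi>\<in>\<Phi>. {f' \<in> topspace ?W. \<phi> f' \<in> ball (\<phi> f) (e / 2)})" if "\<Phi> \<noteq> {}"
          using \<Phi> that
          by (intro openin_INT2 openin_continuous_map_preimage[OF continuous_map_cb_dual]) auto
        then have "openin ?W {f'. \<forall>\<phi>\<in>\<Phi>. \<phi> f' \<in> ball (\<phi> f) (e / 2)}"
          using openin_topspace[of ?W] by (cases "\<Phi> = {}") (auto simp: Collect_ball_eq)
        moreover have "f \<in> {f'. \<forall>\<phi>\<in>\<Phi>. \<phi> f' \<in> ball (\<phi> f) (e / 2)}" using \<Phi>(3) by simp
        ultimately have "\<exists>f'. f' \<in> range k \<and> f' \<in> {f'. \<forall>\<phi>\<in>\<Phi>. \<phi> f' \<in> ball (\<phi> f) (e / 2)}"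
          by (intro iffD1[OF in_closure_of f(2), THEN conjunct2, rule_format] conjI)
        then obtain t where t: "\<forall>\<phi>\<in>\<Phi>. dist (\<phi> f) (\<phi> (k t)) < e / 2" by auto
        have "norm (\<phi> (k t) - p \<phi>) < e" if "\<phi> \<in> \<Phi>" for \<phi>
          using bspec[OF t that] bspec[OF f(1) that] dist_triangle_half_r[of "\<phi> f" "\<phi> (k t)" e "p \<phi>"]
          by (simp add: dist_norm)
        then show "\<exists>t. \<forall>\<phi>\<in>\<Phi>. norm (\<phi> (k t) - p \<phi>) < e" by blast
      qed
      obtain g where g: "limitin ?W k g V"
        by (rule double_limits_agree_weak_limit[OF bound dl V(1)])
      have "p \<phi> = \<phi> g" if "\<phi> \<in> cb_dual" for \<phi>
        using tendsto_unique[OF ultrafilter_not_bot[OF V(1)] bspec[OF V(2) that] limitin_cb_weakD[OF g that]] .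
      then have "limitin ?W id g F" using p by (intro limitin_cb_weakI) simp
      moreover have "g \<in> ?K"
        using limitin_closedin[OF g closedin_closure_of _ ultrafilter_not_bot[OF V(1)], of "range k"] kK
        by simp
      ultimately show "\<exists>l\<in>?K. limitin ?W id l F" by blast
    qed simp
  }
qed


section \<open>Characters of the algebra of weakly almost periodic functions\<close>

lemma charactersD:
  assumes "x \<in> characters A"
  shows "x \<in> extensional A" "\<exists>f\<in>A. x f \<noteq> 0"
    "f \<in> A \<Longrightarrow> g \<in> A \<Longrightarrow> x (f + g) = x f + x g"
    "f \<in> A \<Longrightarrow> g \<in> A \<Longrightarrow> x (cb_mult f g) = x f * x g"
    "f \<in> A \<Longrightarrow> x (cb_scale c f) = c * x f"
  using assms by (simp_all add: characters_def)

lemma topspace_spectrum [simp]: "topspace (spectrum A) = characters A"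
  by (auto simp: spectrum_def characters_def PiE_def)

lemma continuous_map_spectrum_apply:
  "f \<in> A \<Longrightarrow> continuous_map (spectrum A) euclidean (\<lambda>x. x f)"
  unfolding spectrum_def
  by (intro continuous_map_from_subtopology continuous_map_product_projection)

lemma continuous_map_into_spectrum:
  assumes "\<And>t. t \<in> topspace T \<Longrightarrow> h t \<in> characters A"
    and "\<And>f. f \<in> A \<Longrightarrow> continuous_map T euclidean (\<lambda>t. h t f)"
  shows "continuous_map T (spectrum A) h"
  unfolding spectrum_def continuous_map_in_subtopology continuous_map_componentwise
  using assms charactersD(1) by (auto simp: Pi_iff)

lemma Hausdorff_space_spectrum: "Hausdorff_space (spectrum A)"
  unfolding spectrum_def
  by (intro Hausdorff_space_subtopology) (simp add: Hausdorff_space_product_topology)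

text \<open>
  Every character of \<open>wap\<close> is of this form, which turns the Arens product into an iterated limit.
\<close>

definition limit_character :: "'g filter \<Rightarrow> ('g::{topological_space,semigroup_mult} \<Rightarrow>\<^sub>C complex) \<Rightarrow> complex"
  where "limit_character U = (\<lambda>f\<in>wap. Lim U (apply_bcontfun f))"

context
  assumes semitop: "semitopological_semigroup (euclidean :: 'g::{topological_space,semigroup_mult} topology) (*)"
begin

section \<open>Closure properties of \<open>wap\<close>\<close>

lemma wap_iff_double_limits_agree:
  fixes f :: "'g \<Rightarrow>\<^sub>C complex"
  shows "f \<in> wap \<longleftrightarrow> double_limits_agree (\<lambda>s t. f (s * t))"
proof -
  have "norm (ltr t f) \<le> norm f" for t
    by (rule norm_bound) (simp add: apply_ltr[OF semitop] norm_bounded)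
  from grothendieck_double_limit_criterion[of "\<lambda>t. ltr t f", OF this]
  show ?thesis by (simp add: wap_def apply_ltr[OF semitop])
qed

lemma wap_compose2:
  fixes f g :: "'g \<Rightarrow>\<^sub>C complex"
  assumes f: "f \<in> wap" "compact C" "\<And>s. f s \<in> C" and g: "g \<in> wap" "compact D" "\<And>s. g s \<in> D"
    and H: "continuous_on (C \<times> D) (\<lambda>(x, y). H x y)"
  obtains h :: "'g \<Rightarrow>\<^sub>C complex" where "h \<in> wap" "\<forall>s. h s = H (f s) (g s)"
proof -
  have "continuous_on UNIV (\<lambda>s. (\<lambda>(x, y). H x y) (f s, g s))"
    by (rule continuous_on_compose2[OF H]) (auto intro!: continuous_intros simp: f(3) g(3))
  moreover have "bounded (range (\<lambda>s. (\<lambda>(x, y). H x y) (f s, g s)))"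
  proof (rule bounded_subset)
    show "bounded ((\<lambda>(x, y). H x y) ` (C \<times> D))"
      by (intro compact_imp_bounded compact_continuous_image[OF H] compact_Times f(2) g(2))
    show "range (\<lambda>s. (\<lambda>(x, y). H x y) (f s, g s)) \<subseteq> (\<lambda>(x, y). H x y) ` (C \<times> D)"
      by (intro image_subsetI imageI) (simp add: f(3) g(3))
  qed
  ultimately have "(\<lambda>s. H (f s) (g s)) \<in> bcontfun" by (simp add: bcontfun_def)
  then obtain h :: "'g \<Rightarrow>\<^sub>C complex" where h: "(\<lambda>s. H (f s) (g s)) = apply_bcontfun h" by (rule bcontfunE)
  have hs: "h s = H (f s) (g s)" for s by (simp flip: h)
  have "double_limits_agree (\<lambda>s t. H (f (s * t)) (g (s * t)))"
    using f g by (intro double_limits_agree_compose2[OF _ f(2) _ _ g(2) _ H])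
      (auto simp: wap_iff_double_limits_agree)
  then have "h \<in> wap" by (simp add: wap_iff_double_limits_agree hs)
  with hs show thesis by (intro that[of h]) auto
qed

lemma wap_pointwise2:
  fixes f g :: "'g \<Rightarrow>\<^sub>C complex"
  assumes "f \<in> wap" "g \<in> wap" "continuous_on UNIV (\<lambda>(x, y). H x y)"
  obtains h :: "'g \<Rightarrow>\<^sub>C complex" where "h \<in> wap" "\<forall>s. h s = H (f s) (g s)"
  by (rule wap_compose2[OF assms(1) compact_cball[of 0 "norm f"] _ assms(2) compact_cball[of 0 "norm g"] _
        continuous_on_subset[OF assms(3)]]) (auto simp: norm_bounded)

lemma wap_add:
  fixes f g :: "'g \<Rightarrow>\<^sub>C complex"
  assumes "f \<in> wap" "g \<in> wap"
  shows "f + g \<in> wap"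
proof -
  obtain h :: "'g \<Rightarrow>\<^sub>C complex" where "h \<in> wap" "\<forall>s. h s = f s + g s"
    by (rule wap_pointwise2[OF assms, of "(+)"]) (auto simp: case_prod_unfold intro!: continuous_intros)
  moreover from this have "f + g = h" by (intro bcontfun_eqI) simp
  ultimately show ?thesis by simp
qed

lemma wap_mult:
  fixes f g :: "'g \<Rightarrow>\<^sub>C complex"
  assumes "f \<in> wap" "g \<in> wap"
  shows "cb_mult f g \<in> wap"
proof -
  obtain h :: "'g \<Rightarrow>\<^sub>C complex" where "h \<in> wap" "\<forall>s. h s = f s * g s"
    by (rule wap_pointwise2[OF assms, of "(*)"]) (auto simp: case_prod_unfold intro!: continuous_intros)
  moreover from this have "cb_mult f g = h" by (intro bcontfun_eqI) (simp add: apply_cb_mult)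
  ultimately show ?thesis by simp
qed

lemma wap_scale:
  fixes f :: "'g \<Rightarrow>\<^sub>C complex"
  assumes "f \<in> wap"
  shows "cb_scale c f \<in> wap"
proof -
  obtain h :: "'g \<Rightarrow>\<^sub>C complex" where "h \<in> wap" "\<forall>s. h s = c * f s"
    by (rule wap_pointwise2[OF assms assms, of "\<lambda>x y. c * x"])
       (auto simp: case_prod_unfold intro!: continuous_intros)
  moreover from this have "cb_scale c f = h" by (intro bcontfun_eqI) (simp add: apply_cb_scale)
  ultimately show ?thesis by simp
qed

lemma wap_const: "(const_bcontfun c :: 'g \<Rightarrow>\<^sub>C complex) \<in> wap"
  by (simp add: wap_iff_double_limits_agree const_bcontfun.rep_eq double_limits_agree_left)

lemma wap_cnj:
  fixes f :: "'g \<Rightarrow>\<^sub>C complex"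
  assumes "f \<in> wap"
  obtains h :: "'g \<Rightarrow>\<^sub>C complex" where "h \<in> wap" "\<forall>s. h s = cnj (f s)"
  by (rule wap_pointwise2[OF assms assms, of "\<lambda>x y. cnj x"])
     (auto simp: case_prod_unfold intro!: continuous_intros)

lemma wap_inverse:
  fixes f :: "'g \<Rightarrow>\<^sub>C complex"
  assumes "f \<in> wap" "0 < e" "\<And>s. e \<le> norm (f s)"
  obtains h :: "'g \<Rightarrow>\<^sub>C complex" where "h \<in> wap" "\<forall>s. h s = inverse (f s)"
proof -
  \<comment> \<open>A compact annulus containing all values of \<open>f\<close>, on which inversion
    is continuous.\<close>
  let ?C = "cball 0 (norm f) - ball (0 :: complex) e"
  have "compact ?C" by (intro compact_diff) auto
  moreover have "f s \<in> ?C" for s using assms(3)[of s] by (simp add: norm_bounded)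
  moreover have "continuous_on (?C \<times> ?C) (\<lambda>(x, y). inverse x)"
    using assms(2) by (auto simp: case_prod_unfold intro!: continuous_intros)
  ultimately show thesis
    using wap_compose2[OF assms(1) _ _ assms(1), of ?C ?C "\<lambda>x y. inverse x"] that by metis
qed

lemma wap_rtr:
  fixes f :: "'g \<Rightarrow>\<^sub>C complex"
  assumes "f \<in> wap"
  shows "rtr f s \<in> wap"
  using double_limits_agree_pullback[of "\<lambda>s t. f (s * t)" "\<lambda>t. s * t" "\<lambda>t. t"] assms
  by (simp add: wap_iff_double_limits_agree apply_rtr[OF semitop] mult.assoc)

text \<open>
  The function \<open>g\<close> is a weak limit of translates \<open>ltr t f\<close>, and its own translates are again such limits;
  hence the latter lie in the weakly compact set witnessing \<open>f \<in> wap\<close>.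
\<close>

lemma wap_limit_function:
  fixes f :: "'g \<Rightarrow>\<^sub>C complex"
  assumes f: "f \<in> wap" and V: "ultrafilter V"
  obtains g :: "'g \<Rightarrow>\<^sub>C complex" where "g \<in> wap" "\<forall>s. g s = Lim V (\<lambda>t. f (s * t))"
proof -
  let ?W = "cb_weak_topology :: ('g \<Rightarrow>\<^sub>C complex) topology"
  let ?K = "?W closure_of (range (\<lambda>t. ltr t f))"
  have K: "compactin ?W ?K" using f by (simp add: wap_def)
  have inK: "ltr t f \<in> ?K" for t
    using closure_of_subset[of "range (\<lambda>t. ltr t f)" ?W] by auto
  \<comment> \<open>The reparametrisation \<open>p\<close> is general because
    \<open>p t = u * t\<close> describes the translate \<open>ltr u g\<close>.\<close>
  have lim: "\<exists>g\<in>?K. \<forall>s. apply_bcontfun g s = Lim V (\<lambda>t. f (s * p t))" for p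
  proof -
    have "\<forall>\<^sub>F t in V. ltr (p t) f \<in> ?K" using inK by (intro always_eventually allI)
    from compactin_ultrafilter_limit[OF K V this]
    obtain g where g: "g \<in> ?K" "limitin ?W (\<lambda>t. ltr (p t) f) g V" .
    have "Lim V (\<lambda>t. f (s * p t)) = g s" for s
      using limitin_cb_weakD[OF g(2) point_evaluation_in_cb_dual, of s]
      by (intro ultrafilter_Lim_eq[OF V]) (simp add: apply_ltr[OF semitop])
    with g(1) show ?thesis by auto
  qed
  obtain g where g: "\<forall>s. apply_bcontfun g s = Lim V (\<lambda>t. f (s * t))"
    using lim[of "\<lambda>t. t"] by blast
  have "ltr u g \<in> ?K" for u
  proof -
    obtain g' where g': "g' \<in> ?K" "\<forall>s. apply_bcontfun g' s = Lim V (\<lambda>t. f (s * (u * t)))"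
      using lim[of "\<lambda>t. u * t"] by blast
    have "ltr u g = g'"
      by (rule bcontfun_eqI) (simp add: apply_ltr[OF semitop] g g'(2) mult.assoc)
    with g'(1) show ?thesis by simp
  qed
  then have "?W closure_of (range (\<lambda>u. ltr u g)) \<subseteq> ?K"
    by (intro closure_of_minimal) auto
  then have "g \<in> wap"
    unfolding wap_def using closed_compactin[OF K] by simp
  then show thesis using g by (rule that)
qed

section \<open>Characters of \<open>wap\<close> as limits along ultrafilters\<close>

lemma limit_character_in_characters:
  fixes U :: "'g filter"
  assumes U: "ultrafilter U"
  shows "limit_character U \<in> characters wap"
proof -
  have lim: "((\<lambda>x. apply_bcontfun f x) \<longlongrightarrow> Lim U f) U" for f :: "'g \<Rightarrow>\<^sub>C complex"
    by (intro ultrafilter_tendsto_Lim[OF U] bounded_apply_bcontfun)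
  have "Lim U (apply_bcontfun (f + g)) = Lim U f + Lim U g" for f g :: "'g \<Rightarrow>\<^sub>C complex"
    using tendsto_add[OF lim lim, of f g] by (intro ultrafilter_Lim_eq[OF U]) simp
  moreover have "Lim U (apply_bcontfun (cb_mult f g)) = Lim U f * Lim U g" for f g :: "'g \<Rightarrow>\<^sub>C complex"
    using tendsto_mult[OF lim lim, of f g] by (intro ultrafilter_Lim_eq[OF U]) (simp flip: apply_cb_mult)
  moreover have "Lim U (apply_bcontfun (cb_scale c f)) = c * Lim U f" for c and f :: "'g \<Rightarrow>\<^sub>C complex"
    using tendsto_mult[OF tendsto_const lim, of c f]
    by (intro ultrafilter_Lim_eq[OF U]) (simp flip: apply_cb_scale)
  moreover have "Lim U (apply_bcontfun (const_bcontfun 1 :: 'g \<Rightarrow>\<^sub>C complex)) = 1"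
    by (simp add: const_bcontfun.rep_eq Lim_const_ultrafilter[OF U])
  ultimately show ?thesis
    unfolding characters_def limit_character_def
    using wap_const[of 1] by (auto simp: wap_add wap_mult wap_scale intro!: bexI[of _ "const_bcontfun 1"])
qed

lemma character_one:
  fixes x :: "('g \<Rightarrow>\<^sub>C complex) \<Rightarrow> complex"
  assumes x: "x \<in> characters wap"
  shows "x (const_bcontfun 1) = 1"
proof -
  obtain f where f: "f \<in> wap" "x f \<noteq> 0" using charactersD(2)[OF x] by blast
  have "cb_mult f (const_bcontfun 1) = f"
    by (rule bcontfun_eqI) (simp add: apply_cb_mult const_bcontfun.rep_eq)
  then show ?thesis using charactersD(4)[OF x f(1) wap_const[of 1]] f(2) by simp
qed

text \<open>
  If no point approximated \<open>x\<close> on a finite set \<open>\<Phi>\<close>, the sum of the \<open>\<bar>f - x f\<bar>\<^sup>2\<close> over \<open>f \<in> \<Phi>\<close> would be an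
  invertible element of \<open>wap\<close> in the kernel of \<open>x\<close>.
\<close>

lemma character_is_limit_character:
  fixes x :: "('g \<Rightarrow>\<^sub>C complex) \<Rightarrow> complex"
  assumes x: "x \<in> characters wap"
  obtains U where "ultrafilter U" "x = limit_character U"
proof -
  have sq: "\<exists>g\<in>wap. x g = 0 \<and> (\<forall>s. apply_bcontfun g s = of_real (\<Sum>f\<in>\<Phi>. (norm (apply_bcontfun f s - x f))\<^sup>2))"
    if "finite \<Phi>" "\<Phi> \<subseteq> wap" for \<Phi>
    using that
  proof (induction rule: finite_induct)
    case empty
    have "x (cb_scale 0 (const_bcontfun 1)) = 0" by (simp add: charactersD(5)[OF x wap_const])
    then show ?case
      by (intro bexI[OF _ wap_scale[OF wap_const]] conjI) (auto simp: apply_cb_scale)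
  next
    case (insert f \<Phi>)
    then obtain g where g: "g \<in> wap" "x g = 0"
      "\<forall>s. apply_bcontfun g s = of_real (\<Sum>f\<in>\<Phi>. (norm (apply_bcontfun f s - x f))\<^sup>2)" by auto
    define q where "q = f + cb_scale (- x f) (const_bcontfun 1)"
    have c: "cb_scale (- x f) (const_bcontfun 1 :: 'g \<Rightarrow>\<^sub>C complex) \<in> wap" by (intro wap_scale wap_const)
    have f: "f \<in> wap" using insert.prems by simp
    have q: "q \<in> wap" unfolding q_def by (intro wap_add f c)
    have xq: "x q = 0"
      using charactersD(3)[OF x f c] charactersD(5)[OF x wap_const, of "- x f" 1]
      by (simp add: q_def character_one[OF x])
    \<comment> \<open>Compatibility of \<open>x\<close> with conjugation has not been established,
      but \<open>x q = 0\<close> already annihilates \<open>cb_mult q r\<close>.\<close>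
    obtain r :: "'g \<Rightarrow>\<^sub>C complex" where r: "r \<in> wap" "\<forall>s. r s = cnj (q s)" by (rule wap_cnj[OF q])
    have "x (cb_mult q r + g) = 0"
      using charactersD(3)[OF x wap_mult[OF q r(1)] g(1)] charactersD(4)[OF x q r(1)] xq g(2) by simp
    moreover have "cb_mult q r + g \<in> wap" by (intro wap_add wap_mult q r(1) g(1))
    moreover have "(cb_mult q r + g) s = of_real (\<Sum>f\<in>insert f \<Phi>. (norm (apply_bcontfun f s - x f))\<^sup>2)" for s
    proof -
      have "q s = f s - x f" by (simp add: q_def apply_cb_scale const_bcontfun.rep_eq)
      then show ?thesis
        using insert.hyps by (simp add: apply_cb_mult r(2) g(3) flip: complex_norm_square)
    qed
    ultimately show ?case by blast
  qed
  have "\<exists>s. \<forall>f\<in>\<Phi>. norm (apply_bcontfun f s - x f) < e"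
    if \<Phi>: "finite \<Phi>" "\<Phi> \<subseteq> wap" "0 < e" for \<Phi> :: "('g \<Rightarrow>\<^sub>C complex) set" and e
  proof (rule ccontr)
    assume "\<not> ?thesis"
    then have far: "\<exists>f\<in>\<Phi>. e \<le> norm (apply_bcontfun f s - x f)" for s by (auto simp: not_less)
    obtain g where g: "g \<in> wap" "x g = 0"
      "\<forall>s. apply_bcontfun g s = of_real (\<Sum>f\<in>\<Phi>. (norm (apply_bcontfun f s - x f))\<^sup>2)" using sq[OF \<Phi>(1,2)] by blast
    have low: "e\<^sup>2 \<le> norm (g s)" for s
    proof -
      obtain f where f: "f \<in> \<Phi>" "e \<le> norm (apply_bcontfun f s - x f)" using far by blast
      have "e\<^sup>2 \<le> (norm (apply_bcontfun f s - x f))\<^sup>2" using f(2) \<Phi>(3) by (intro power_mono) auto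
      also have "\<dots> \<le> (\<Sum>f\<in>\<Phi>. (norm (apply_bcontfun f s - x f))\<^sup>2)"
        using f(1) \<Phi>(1) by (intro member_le_sum) auto
      also have "\<dots> \<le> norm (g s)" unfolding spec[OF g(3)] norm_of_real by simp
      finally show ?thesis .
    qed
    have e2: "0 < e\<^sup>2" using \<Phi>(3) by simp
    obtain h :: "'g \<Rightarrow>\<^sub>C complex" where h: "h \<in> wap" "\<forall>s. h s = inverse (g s)"
      by (rule wap_inverse[OF g(1) e2 low])
    have "g s \<noteq> 0" for s using low[of s] e2 by auto
    then have "cb_mult g h = const_bcontfun 1"
      by (intro bcontfun_eqI) (simp add: apply_cb_mult h(2) const_bcontfun.rep_eq)
    then show False
      using charactersD(4)[OF x g(1) h(1)] g(2) character_one[OF x] by simp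
  qed
  then obtain U where U: "ultrafilter U" "\<forall>f\<in>wap. ((\<lambda>s. apply_bcontfun f s) \<longlongrightarrow> x f) U"
    by (rule ultrafilter_simultaneous_limits[of wap "\<lambda>s f. apply_bcontfun f s" x])
  have "x = limit_character U"
  proof
    fix f
    show "x f = limit_character U f"
    proof (cases "f \<in> wap")
      case True
      then show ?thesis using ultrafilter_Lim_eq[OF U(1) bspec[OF U(2) True]]
        by (simp add: limit_character_def)
    next
      case False
      then show ?thesis using charactersD(1)[OF x] by (simp add: limit_character_def extensional_def)
    qed
  qed
  with U(1) show thesis by (rule that)
qed

text \<open>Characters are contractive, being limits of evaluations, so they converge pointwise
  along an ultrafilter. The algebraic identities pass to the limit, and the value 1 at the unit
  keeps it nonzero.\<close>

lemma compact_space_spectrum_wap: "compact_space (spectrum (wap :: ('g \<Rightarrow>\<^sub>C complex) set))"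
  unfolding spectrum_def
proof (rule compact_space_subtopology, rule compactin_ultrafilterI)
  let ?A = "wap :: ('g \<Rightarrow>\<^sub>C complex) set"
  show "characters ?A \<subseteq> topspace (product_topology (\<lambda>_. euclidean) ?A)"
    using charactersD(1) by (auto simp: PiE_def)
  fix F assume F: "ultrafilter F" and ev: "\<forall>\<^sub>F x in F. x \<in> characters ?A"
  have "\<exists>l. ((\<lambda>x. x f) \<longlongrightarrow> l) F" if f: "f \<in> ?A" for f
  proof -
    have "\<forall>\<^sub>F x in F. x f \<in> cball 0 (norm f)"
      using ev
    proof eventually_elim
      case (elim x)
      then obtain U where U: "ultrafilter U" "x = limit_character U"
        by (rule character_is_limit_character)
      then show ?case
        using f ultrafilter_norm_Lim_le[OF U(1), of f "norm f"] by (simp add: limit_character_def norm_bounded)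
    qed
    moreover have "compactin euclidean (cball 0 (norm f) :: complex set)" by simp
    ultimately obtain l where "limitin euclidean (\<lambda>x. x f) l F"
      using compactin_ultrafilter_limit[OF _ F, of euclidean "cball 0 (norm f)" "\<lambda>x. x f"] by metis
    then show ?thesis by auto
  qed
  then obtain l0 where l0: "\<And>f. f \<in> ?A \<Longrightarrow> ((\<lambda>x. x f) \<longlongrightarrow> l0 f) F" by metis
  define l where "l = restrict l0 ?A"
  have l: "((\<lambda>x. x f) \<longlongrightarrow> l f) F" if "f \<in> ?A" for f
    using l0[OF that] that by (simp add: l_def)
  note nb = ultrafilter_not_bot[OF F]
  have eqI: "a = b" if "(p \<longlongrightarrow> a) F" "(q \<longlongrightarrow> b) F" "\<And>x. x \<in> characters ?A \<Longrightarrow> p x = q x"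
    for p q :: "(('g \<Rightarrow>\<^sub>C complex) \<Rightarrow> complex) \<Rightarrow> complex" and a b
  proof (rule tendsto_unique[OF nb that(1)])
    show "(p \<longlongrightarrow> b) F"
      by (rule Lim_transform_eventually[OF that(2)]) (use ev that(3) in \<open>auto elim: eventually_mono\<close>)
  qed
  have "l (f + g) = l f + l g" if "f \<in> ?A" "g \<in> ?A" for f g
    using that by (intro eqI[OF l tendsto_add[OF l l]] wap_add charactersD(3))
  moreover have "l (cb_mult f g) = l f * l g" if "f \<in> ?A" "g \<in> ?A" for f g
    using that by (intro eqI[OF l tendsto_mult[OF l l]] wap_mult charactersD(4))
  moreover have "l (cb_scale c f) = c * l f" if "f \<in> ?A" for c f
    using that by (intro eqI[OF l tendsto_mult[OF tendsto_const l]] wap_scale charactersD(5))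
  moreover have "l (const_bcontfun 1) = 1"
    by (intro eqI[OF l tendsto_const] wap_const character_one)
  ultimately have "l \<in> characters ?A"
    unfolding characters_def using wap_const[of 1]
    by (auto simp: l_def intro!: bexI[of _ "const_bcontfun 1"])
  moreover have "limitin (product_topology (\<lambda>_. euclidean) ?A) id l F"
    unfolding limitin_componentwise
  proof (intro conjI ballI)
    show "\<forall>\<^sub>F x in F. id x \<in> topspace (product_topology (\<lambda>_. euclidean) ?A)"
      using ev by eventually_elim (use charactersD(1) in \<open>auto simp: PiE_def\<close>)
  qed (use l in \<open>simp_all add: l_def\<close>)
  ultimately show "\<exists>l\<in>characters ?A. limitin (product_topology (\<lambda>_. euclidean) ?A) id l F" by blast
qed

end


section \<open>Involutive compactifications\<close>

text \<open>Left translation by \<open>t\<close> is right translation by \<open>star t\<close>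
  conjugated with \<open>star\<close>.\<close>

lemma semitopological_if_continuous_involution:
  assumes S: "right_topological_semigroup S m" and star: "continuous_involution S m star"
  shows "semitopological_semigroup S m"
proof -
  have sg: "semigroup_on (topspace S) m"
    and rt: "\<And>t. t \<in> topspace S \<Longrightarrow> continuous_map S S (\<lambda>s. m s t)"
    using S by (auto simp: right_topological_semigroup_def)
  have cont: "continuous_map S S star" and inv: "involution_on (topspace S) m star"
    using star by (auto simp: continuous_involution_def)
  have "continuous_map S S (\<lambda>s. m t s)" if t: "t \<in> topspace S" for t
  proof (rule continuous_map_eq)
    have "star t \<in> topspace S" using inv t by (simp add: involution_on_def)
    from continuous_map_compose[OF continuous_map_compose[OF cont rt[OF this]] cont]
    show "continuous_map S S (star \<circ> ((\<lambda>s. m s (star t)) \<circ> star))" .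
    show "(star \<circ> ((\<lambda>s. m s (star t)) \<circ> star)) s = m t s" if "s \<in> topspace S" for s
      using inv t that by (simp add: involution_on_def)
  qed
  then show ?thesis using sg rt by (simp add: semitopological_semigroup_def)
qed

text \<open>The star of \<open>F \<circ> \<delta>\<close> is
  \<open>(cnj \<circ> F \<circ> starS) \<circ> \<delta>\<close>. Isometry follows from contractivity
  applied twice to an involutive map.\<close>

lemma isometric_involution_on_C_comp:
  fixes star :: "'g::topological_space \<Rightarrow> 'g"
  assumes cont: "continuous_on UNIV star" and inv: "\<And>s. star (star s) = s"
    and starS: "continuous_map S S starS" "\<And>s. \<delta> (star s) = starS (\<delta> s)"
  shows "isometric_involution_on (C_comp S \<delta>) (cb_star star)"
proof -
  note app = apply_cb_star[OF cont]
  have invol: "cb_star star (cb_star star f) = f" for f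
    by (rule bcontfun_eqI) (simp add: app inv)
  have le: "norm (cb_star star f) \<le> norm f" for f
    by (rule norm_bound) (simp add: app norm_bounded)
  have "norm (cb_star star f) = norm f" for f
    using le[of f] le[of "cb_star star f"] by (simp add: invol)
  moreover have "cb_star star h \<in> C_comp S \<delta>" if h: "h \<in> C_comp S \<delta>" for h
  proof -
    obtain F where F: "continuous_map S euclidean F" "apply_bcontfun h = F \<circ> \<delta>"
      using h by (auto simp: C_comp_def)
    have "continuous_map S euclidean (cnj \<circ> (F \<circ> starS))"
      by (intro continuous_map_compose[OF continuous_map_compose[OF starS(1) F(1)]])
         (simp add: continuous_intros)
    moreover have "apply_bcontfun (cb_star star h) = (cnj \<circ> (F \<circ> starS)) \<circ> \<delta>"
      by (rule ext) (simp add: app F(2) starS(2))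
    ultimately show ?thesis by (auto simp: C_comp_def)
  qed
  moreover have "cb_star star (f + g) = cb_star star f + cb_star star g" for f g
    by (rule bcontfun_eqI) (simp add: app)
  moreover have "cb_star star (cb_mult f g) = cb_mult (cb_star star g) (cb_star star f)" for f g
    by (rule bcontfun_eqI) (simp add: app apply_cb_mult mult.commute)
  moreover have "cb_star star (cb_scale c f) = cb_scale (cnj c) (cb_star star f)" for c f
    by (rule bcontfun_eqI) (simp add: app apply_cb_scale)
  ultimately show ?thesis using invol by (simp add: isometric_involution_on_def)
qed

lemma ultrafilter_principal: "ultrafilter (principal {s})"
  by (auto simp: ultrafilter_def eventually_principal principal_eq_bot_iff)

lemma Lim_principal_singleton: "Lim (principal {s}) f = (f s :: 'b::t2_space)"
  by (rule ultrafilter_Lim_eq[OF ultrafilter_principal]) (auto simp: tendsto_def eventually_principal)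

text \<open>Principal ultrafilters bring evaluations under the results on limit characters.\<close>

lemma evaluation_eq_limit_character: "evaluation wap s = limit_character (principal {s})"
  by (simp add: evaluation_def limit_character_def Lim_principal_singleton)

lemma limit_character_apply: "f \<in> wap \<Longrightarrow> limit_character U f = Lim U (apply_bcontfun f)"
  by (simp add: limit_character_def)

lemma Lim_cnj:
  assumes "ultrafilter U" "bounded (range f)"
  shows "Lim U (\<lambda>s. cnj (f s)) = cnj (Lim U f)"
  by (intro ultrafilter_Lim_eq[OF assms(1)] tendsto_cnj ultrafilter_tendsto_Lim assms)

lemma limitin_spectrumI:
  assumes "x \<in> characters A" "\<And>t. k t \<in> characters A" "\<And>f. f \<in> A \<Longrightarrow> ((\<lambda>t. k t f) \<longlongrightarrow> x f) F"
  shows "limitin (spectrum A) k x F"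
  unfolding spectrum_def limitin_subtopology limitin_componentwise
  using assms charactersD(1) by (auto simp: PiE_def)

context
  assumes semitop: "semitopological_semigroup (euclidean :: 'g::{topological_space,semigroup_mult} topology) (*)"
begin

section \<open>The semigroup structure of the spectrum\<close>

lemma evaluation_in_characters: "evaluation wap (s :: 'g) \<in> characters wap"
  by (simp add: evaluation_eq_limit_character limit_character_in_characters[OF semitop ultrafilter_principal])

text \<open>Writing \<open>y\<close> as a limit along \<open>V\<close> identifies
  \<open>s \<mapsto> y (rtr f s)\<close> with the function of \<open>wap_limit_function\<close>; in
  particular \<open>Bcontfun\<close> is applied to a bounded continuous function.\<close>

lemma arens_action:
  fixes f :: "'g \<Rightarrow>\<^sub>C complex"
  assumes y: "y \<in> characters wap" and f: "f \<in> wap"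
  shows "arens_action y f \<in> wap" "arens_action y f s = y (rtr f s)"
proof -
  obtain V where V: "ultrafilter V" "y = limit_character V"
    by (rule character_is_limit_character[OF semitop y])
  obtain g :: "'g \<Rightarrow>\<^sub>C complex" where g: "g \<in> wap" "\<forall>s. g s = Lim V (\<lambda>t. f (s * t))"
    by (rule wap_limit_function[OF semitop f V(1)])
  have "y (rtr f s) = g s" for s
    by (simp add: V(2) g(2) limit_character_apply[OF wap_rtr[OF semitop f]] apply_rtr[OF semitop, abs_def])
  then have "arens_action y f = g"
    by (simp add: arens_action_def apply_bcontfun_inverse)
  with g(1) \<open>\<And>s. y (rtr f s) = g s\<close> show "arens_action y f \<in> wap" "arens_action y f s = y (rtr f s)"
    by simp_all
qed

lemma arens_product_apply:
  "f \<in> A \<Longrightarrow> arens_product A x y f = x (arens_action y f)"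
  by (simp add: arens_product_def)

lemma arens_product_limit_character:
  fixes f :: "'g \<Rightarrow>\<^sub>C complex"
  assumes V: "ultrafilter V" and f: "f \<in> wap"
  shows "arens_product wap (limit_character U) (limit_character V) f = Lim U (\<lambda>s. Lim V (\<lambda>t. f (s * t)))"
proof -
  note lc = limit_character_in_characters[OF semitop V]
  have "apply_bcontfun (arens_action (limit_character V) f) = (\<lambda>s. Lim V (\<lambda>t. f (s * t)))"
    by (rule ext)
       (simp add: arens_action(2)[OF lc f] limit_character_apply[OF wap_rtr[OF semitop f]]
         apply_rtr[OF semitop, abs_def])
  then show ?thesis
    by (simp add: arens_product_apply[OF f] limit_character_apply[OF arens_action(1)[OF lc f]])
qed

text \<open>The product is the limit along \<open>U\<close> of the characters given by the
  translated ultrafilters \<open>s * V\<close>, and compactness of the spectrum makes that limit a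
  character.\<close>

lemma arens_product_in_characters:
  fixes x y :: "('g \<Rightarrow>\<^sub>C complex) \<Rightarrow> complex"
  assumes x: "x \<in> characters wap" and y: "y \<in> characters wap"
  shows "arens_product wap x y \<in> characters wap"
proof -
  obtain U where U: "ultrafilter U" "x = limit_character U"
    by (rule character_is_limit_character[OF semitop x])
  obtain V where V: "ultrafilter V" "y = limit_character V"
    by (rule character_is_limit_character[OF semitop y])
  define k where "k s = limit_character (filtermap (\<lambda>t. s * t) V)" for s
  have k: "k s \<in> characters wap" for s
    unfolding k_def by (intro limit_character_in_characters[OF semitop] ultrafilter_filtermap V(1))
  have "compactin (spectrum wap) (characters (wap :: ('g \<Rightarrow>\<^sub>C complex) set))"
    using compact_space_spectrum_wap[OF semitop] by (simp add: compact_space_def)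
  then obtain l where l: "l \<in> characters wap" "limitin (spectrum wap) k l U"
    by (rule compactin_ultrafilter_limit[OF _ U(1), of _ _ k]) (simp add: k)
  have "arens_product wap x y f = l f" for f
  proof (cases "f \<in> wap")
    case True
    have "((\<lambda>s. k s f) \<longlongrightarrow> l f) U"
      using continuous_map_limit[OF continuous_map_spectrum_apply[OF True] l(2)] by (simp add: o_def)
    then have "Lim U (\<lambda>s. k s f) = l f" by (rule ultrafilter_Lim_eq[OF U(1)])
    moreover have "k s f = Lim V (\<lambda>t. f (s * t))" for s
      by (simp add: k_def limit_character_apply[OF True] Lim_filtermap)
    ultimately show ?thesis
      using arens_product_limit_character[OF V(1) True, of U] by (simp add: U(2) V(2))
  next
    case False
    then show ?thesis using charactersD(1)[OF l(1)] by (simp add: arens_product_def extensional_def)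
  qed
  then have "arens_product wap x y = l" by (rule ext)
  with l(1) show ?thesis by simp
qed

text \<open>The action commutes with \<open>rtr\<close>, so acting by \<open>z\<close> and then by
  \<open>y\<close> is acting by their product; \<open>x\<close> is then applied to equal
  functions.\<close>

lemma arens_product_assoc:
  fixes x y z :: "('g \<Rightarrow>\<^sub>C complex) \<Rightarrow> complex"
  assumes y: "y \<in> characters wap" and z: "z \<in> characters wap"
  shows "arens_product wap (arens_product wap x y) z = arens_product wap x (arens_product wap y z)"
proof
  fix f :: "'g \<Rightarrow>\<^sub>C complex"
  show "arens_product wap (arens_product wap x y) z f = arens_product wap x (arens_product wap y z) f"
  proof (cases "f \<in> wap")
    case f: True
    have rr: "rtr (rtr f s) t = rtr f (s * t)" for s t
      by (rule bcontfun_eqI) (simp add: apply_rtr[OF semitop] mult.assoc)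
    have "rtr (arens_action z f) s = arens_action z (rtr f s)" for s
      by (rule bcontfun_eqI)
         (simp add: apply_rtr[OF semitop] arens_action(2)[OF z f] arens_action(2)[OF z wap_rtr[OF semitop f]] rr)
    then have "arens_action y (arens_action z f) = arens_action (arens_product wap y z) f"
      by (intro bcontfun_eqI)
         (simp add: arens_action(2)[OF y arens_action(1)[OF z f]]
           arens_action(2)[OF arens_product_in_characters[OF y z] f]
           arens_product_apply[OF wap_rtr[OF semitop f]])
    then show ?thesis
      by (simp add: arens_product_apply f arens_action(1)[OF z f])
  qed (simp add: arens_product_def)
qed

lemma right_topological_semigroup_spectrum_wap:
  "right_topological_semigroup (spectrum wap) (arens_product (wap :: ('g \<Rightarrow>\<^sub>C complex) set))"
  unfolding right_topological_semigroup_def semigroup_on_def topspace_spectrum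
proof (intro conjI ballI)
  fix y :: "('g \<Rightarrow>\<^sub>C complex) \<Rightarrow> complex" assume y: "y \<in> characters wap"
  show "continuous_map (spectrum wap) (spectrum wap) (\<lambda>x. arens_product wap x y)"
  proof (rule continuous_map_into_spectrum)
    show "arens_product wap x y \<in> characters wap" if "x \<in> topspace (spectrum wap)" for x
      using that y by (simp add: arens_product_in_characters)
    show "continuous_map (spectrum wap) euclidean (\<lambda>x. arens_product wap x y f)" if "f \<in> wap" for f
      using continuous_map_spectrum_apply[OF arens_action(1)[OF y that]]
      by (simp add: arens_product_apply[OF that])
  qed
qed (simp_all add: arens_product_in_characters arens_product_assoc)

lemma evaluation_mult:
  "evaluation wap ((s :: 'g) * t) = arens_product wap (evaluation wap s) (evaluation wap t)"
proof
  fix f :: "'g \<Rightarrow>\<^sub>C complex"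
  show "evaluation wap (s * t) f = arens_product wap (evaluation wap s) (evaluation wap t) f"
  proof (cases "f \<in> wap")
    case True
    show ?thesis
      using arens_product_limit_character[OF ultrafilter_principal True, of "principal {s}" t] True
      by (simp add: evaluation_eq_limit_character[symmetric] Lim_principal_singleton) (simp add: evaluation_def)
  qed (simp add: evaluation_def arens_product_def)
qed

lemma evaluation_dense:
  "spectrum wap closure_of range (evaluation wap) = characters (wap :: ('g \<Rightarrow>\<^sub>C complex) set)"
proof (intro equalityI subsetI)
  let ?cl = "spectrum wap closure_of range (evaluation (wap :: ('g \<Rightarrow>\<^sub>C complex) set))"
  fix x :: "('g \<Rightarrow>\<^sub>C complex) \<Rightarrow> complex" assume x: "x \<in> characters wap"
  obtain U where U: "ultrafilter U" "x = limit_character U"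
    by (rule character_is_limit_character[OF semitop x])
  have "limitin (spectrum wap) (evaluation wap) x U"
  proof (rule limitin_spectrumI[OF x evaluation_in_characters])
    fix f :: "'g \<Rightarrow>\<^sub>C complex" assume f: "f \<in> wap"
    show "((\<lambda>s. evaluation wap s f) \<longlongrightarrow> x f) U"
      using ultrafilter_tendsto_Lim[OF U(1) bounded_apply_bcontfun[of f]] f
      by (simp add: evaluation_def U(2) limit_character_apply)
  qed
  moreover have "evaluation wap s \<in> ?cl" for s :: 'g
  proof -
    have "range (evaluation (wap :: ('g \<Rightarrow>\<^sub>C complex) set)) \<subseteq> topspace (spectrum wap)"
      by (simp add: image_subset_iff evaluation_in_characters)
    from closure_of_subset[OF this] show ?thesis by blast
  qed
  ultimately show "x \<in> ?cl"
    by (intro limitin_closedin[OF _ closedin_closure_of _ ultrafilter_not_bot[OF U(1)]]) auto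
qed (use closure_of_subset_topspace[of "spectrum wap"] in auto)

lemma continuous_map_evaluation:
  "continuous_map euclidean (spectrum wap) (evaluation (wap :: ('g \<Rightarrow>\<^sub>C complex) set))"
proof (rule continuous_map_into_spectrum[OF evaluation_in_characters])
  fix f :: "'g \<Rightarrow>\<^sub>C complex" assume "f \<in> wap"
  then show "continuous_map euclidean euclidean (\<lambda>s. evaluation wap s f)"
    by (simp add: evaluation_def)
qed

section \<open>The involution on the spectrum\<close>

lemma involutive_compactification_wap:
  fixes star :: "'g \<Rightarrow> 'g"
  assumes star: "continuous_involution euclidean (*) star"
  shows "involutive_compactification star
    (evaluation (wap :: ('g \<Rightarrow>\<^sub>C complex) set)) (spectrum wap) (arens_product wap)"
proof -
  have cont: "continuous_on UNIV star" and inv: "\<And>s. star (star s) = s"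
    and anti: "\<And>s t. star (s * t) = star t * star s"
    using star by (auto simp: continuous_involution_def involution_on_def)
  note app = apply_cb_star[OF cont]
  have dl: "double_limits_agree (\<lambda>s t. f (star t * star s))" if "f \<in> wap" for f :: "'g \<Rightarrow>\<^sub>C complex"
    using double_limits_agree_swap[OF double_limits_agree_pullback[of "\<lambda>s t. f (s * t)" star star]] that
    by (simp add: wap_iff_double_limits_agree[OF semitop])
  have bdd: "bounded (range (\<lambda>s. apply_bcontfun f (p s)))" for f :: "'g \<Rightarrow>\<^sub>C complex" and p :: "'g \<Rightarrow> 'g"
    by (rule bounded_subset[OF bounded_apply_bcontfun[of f]]) auto
  have star_wap: "cb_star star f \<in> wap" if f: "f \<in> wap" for f :: "'g \<Rightarrow>\<^sub>C complex"
  proof -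
    have "continuous_on (cball 0 (norm f) \<times> cball 0 (norm f)) (\<lambda>(x, y :: complex). cnj x)"
      by (auto simp: case_prod_unfold intro!: continuous_intros)
    then have "double_limits_agree (\<lambda>s t. cnj (f (star t * star s)))"
      by (rule double_limits_agree_compose2[OF dl[OF f] compact_cball _ dl[OF f] compact_cball, rotated 2])
         (simp_all add: norm_bounded)
    then show ?thesis by (simp add: wap_iff_double_limits_agree[OF semitop] app anti)
  qed
  define starT where "starT x = (\<lambda>f\<in>wap. cnj (x (cb_star star f)))" for x :: "('g \<Rightarrow>\<^sub>C complex) \<Rightarrow> complex"
  \<comment> \<open>On limit characters \<open>starT\<close> pushes the ultrafilter forward along
    \<open>star\<close>, which yields both its values in the spectrum and its involutivity.\<close>
  have starT_lc: "starT (limit_character U) = limit_character (filtermap star U)" if U: "ultrafilter U" for U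
  proof
    fix f :: "'g \<Rightarrow>\<^sub>C complex"
    show "starT (limit_character U) f = limit_character (filtermap star U) f"
    proof (cases "f \<in> wap")
      case True
      then show ?thesis
        using Lim_cnj[OF U bdd[of f star]]
        by (simp add: starT_def limit_character_apply star_wap app[abs_def] Lim_filtermap)
    qed (simp add: starT_def limit_character_def)
  qed
  have starT_char: "starT x \<in> characters wap" if x: "x \<in> characters wap" for x
  proof -
    obtain U where U: "ultrafilter U" "x = limit_character U"
      by (rule character_is_limit_character[OF semitop x])
    then show ?thesis
      by (simp add: starT_lc limit_character_in_characters[OF semitop] ultrafilter_filtermap)
  qed
  have starT_inv: "starT (starT x) = x" if x: "x \<in> characters wap" for x
  proof -
    obtain U where U: "ultrafilter U" "x = limit_character U"
      by (rule character_is_limit_character[OF semitop x])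
    then show ?thesis
      by (simp add: starT_lc ultrafilter_filtermap filtermap_filtermap inv)
  qed
  have starT_anti: "starT (arens_product wap x y) = arens_product wap (starT y) (starT x)"
    if x: "x \<in> characters wap" and y: "y \<in> characters wap" for x y
  proof
    fix f :: "'g \<Rightarrow>\<^sub>C complex"
    obtain U where U: "ultrafilter U" "x = limit_character U"
      by (rule character_is_limit_character[OF semitop x])
    obtain V where V: "ultrafilter V" "y = limit_character V"
      by (rule character_is_limit_character[OF semitop y])
    show "starT (arens_product wap x y) f = arens_product wap (starT y) (starT x) f"
    proof (cases "f \<in> wap")
      case f: True
      have bd: "bounded (range (\<lambda>s. Lim V (\<lambda>t. f (star t * star s))))"
        using ultrafilter_norm_Lim_le[OF V(1), of "\<lambda>t. f (star t * star s)" "norm f" for s]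
        by (auto simp: bounded_iff norm_bounded)
      have "arens_product wap x y (cb_star star f) = Lim U (\<lambda>s. Lim V (\<lambda>t. cnj (f (star t * star s))))"
        by (simp add: U(2) V(2) arens_product_limit_character[OF V(1) star_wap[OF f]] app anti)
      also have "\<dots> = Lim U (\<lambda>s. cnj (Lim V (\<lambda>t. f (star t * star s))))"
        by (simp add: Lim_cnj[OF V(1) bdd])
      also have "\<dots> = cnj (Lim U (\<lambda>s. Lim V (\<lambda>t. f (star t * star s))))"
        by (rule Lim_cnj[OF U(1) bd])
      finally have "starT (arens_product wap x y) f = Lim U (\<lambda>s. Lim V (\<lambda>t. f (star t * star s)))"
        by (simp add: starT_def f)
      \<comment> \<open>The interchange of limits is what reverses the order of the factors.\<close>
      also have "\<dots> = Lim V (\<lambda>t. Lim U (\<lambda>s. f (star t * star s)))"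
        by (rule double_limits_agreeD[OF dl[OF f] U(1) V(1)])
      also have "\<dots> = arens_product wap (starT y) (starT x) f"
        by (simp add: U(2) V(2) starT_lc U(1) V(1) Lim_filtermap
            arens_product_limit_character[OF ultrafilter_filtermap[OF U(1)] f])
      finally show ?thesis .
    qed (simp add: starT_def arens_product_def)
  qed
  have "continuous_map (spectrum wap) (spectrum wap) starT"
  proof (rule continuous_map_into_spectrum)
    show "starT x \<in> characters wap" if "x \<in> topspace (spectrum wap)" for x
      using that starT_char by simp
    fix f :: "'g \<Rightarrow>\<^sub>C complex" assume f: "f \<in> wap"
    have "continuous_map (spectrum wap) euclidean (cnj \<circ> (\<lambda>x. x (cb_star star f)))"
      by (rule continuous_map_compose[OF continuous_map_spectrum_apply[OF star_wap[OF f]]])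
         (simp add: continuous_intros)
    then show "continuous_map (spectrum wap) euclidean (\<lambda>x. starT x f)"
      by (simp add: starT_def f o_def)
  qed
  then have invT: "continuous_involution (spectrum wap) (arens_product wap) starT"
    using starT_char starT_inv starT_anti
    by (simp add: continuous_involution_def involution_on_def)
  have evT: "evaluation wap (star s) = starT (evaluation wap s)" for s
    by (rule ext) (simp add: evaluation_def starT_def star_wap app)
  note rts = right_topological_semigroup_spectrum_wap
  \<comment> \<open>The involution just built makes the spectrum semitopological, which places the
    evaluations in the topological centre.\<close>
  have "continuous_map (spectrum wap) (spectrum wap) (\<lambda>x. arens_product wap (evaluation wap s) x)" for s :: 'g
    using semitopological_if_continuous_involution[OF rts invT] evaluation_in_characters
    by (simp add: semitopological_semigroup_def)
  then have "range (evaluation (wap :: ('g \<Rightarrow>\<^sub>C complex) set)) \<subseteq> topological_centre (spectrum wap) (arens_product wap)"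
    by (auto simp: topological_centre_def evaluation_in_characters)
  then have "right_topological_compactification
      (evaluation (wap :: ('g \<Rightarrow>\<^sub>C complex) set)) (spectrum wap) (arens_product wap)"
    unfolding right_topological_compactification_def
    by (simp add: compact_space_spectrum_wap[OF semitop] Hausdorff_space_spectrum rts
        continuous_map_evaluation evaluation_mult evaluation_dense)
  then show ?thesis
    unfolding involutive_compactification_def using invT evT by blast
qed

end

section \<open>The factor map\<close>

lemma Hausdorff_compact_separation:
  assumes "compact_space S" "Hausdorff_space S" "openin S W" "p \<in> W"
  obtains F :: "'s \<Rightarrow> complex" where "continuous_map S euclidean F" "F p = 0"
    "\<And>q. q \<in> topspace S - W \<Longrightarrow> F q = 1"
proof -
  have "completely_regular_space S"
    using assms by (intro normal_imp_completely_regular_space compact_Hausdorff_or_regular_imp_normal_space) auto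
  then obtain f where f: "continuous_map S euclideanreal f" "f p = 0" "f ` (topspace S - W) \<subseteq> {1}"
    using assms(3,4) unfolding completely_regular_space_alt' by metis
  have "continuous_map S euclidean (complex_of_real \<circ> f)"
    by (rule continuous_map_compose[OF f(1)]) (simp add: continuous_intros)
  then show thesis by (rule that) (use f in auto)
qed

text \<open>
  The morphism sends the character \<open>lim U\<close> to the limit \<open>p\<close> of \<open>\<delta>\<close> along \<open>U\<close>; it is well-defined because
  \<open>p\<close> is determined by the values \<open>F p = lim U (F \<circ> \<delta>)\<close> for \<open>F \<in> C(S)\<close>, and \<open>C(S) \<circ> \<delta> \<subseteq> wap\<close>.
\<close>

lemma factor_of_wap_compactification:
  fixes \<delta> :: "'g::{topological_space,semigroup_mult} \<Rightarrow> 's"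
  assumes semitop: "semitopological_semigroup (euclidean :: 'g topology) (*)"
    and comp: "right_topological_compactification \<delta> S m" and S: "semitopological_semigroup S m"
  shows "factor_of \<delta> S m (evaluation (wap :: ('g \<Rightarrow>\<^sub>C complex) set)) (spectrum wap) (arens_product wap)"
proof -
  have cS: "compact_space S" and hS: "Hausdorff_space S" and \<delta>: "continuous_map euclidean S \<delta>"
    and hom: "\<And>s t. \<delta> (s * t) = m (\<delta> s) (\<delta> t)"
    using comp by (auto simp: right_topological_compactification_def)
  have right: "continuous_map S S (\<lambda>s. m s t)" and left: "continuous_map S S (\<lambda>s. m t s)"
    and closed: "\<And>s. s \<in> topspace S \<Longrightarrow> m s t \<in> topspace S" if "t \<in> topspace S" for t
    using S that by (auto simp: semitopological_semigroup_def semigroup_on_def)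
  have \<delta>S: "\<delta> s \<in> topspace S" for s
    using continuous_map_funspace[OF \<delta>] by auto
  define pull where "pull F = (Bcontfun (F \<circ> \<delta>) :: 'g \<Rightarrow>\<^sub>C complex)" for F
  have pull: "pull F s = F (\<delta> s)" if F: "continuous_map S euclidean F" for F s
  proof -
    have "compactin euclidean (F ` topspace S)"
      using cS F by (intro image_compactin) (auto simp: compact_space_def)
    then have "bounded (F ` topspace S)" by (simp add: compact_imp_bounded)
    then have "bounded (range (F \<circ> \<delta>))" by (rule bounded_subset) (use \<delta>S in auto)
    moreover have "continuous_on UNIV (F \<circ> \<delta>)"
      using continuous_map_compose[OF \<delta> F] by simp
    ultimately show ?thesis by (simp add: pull_def Bcontfun_inverse bcontfun_def)
  qed
  have limS: "\<exists>p\<in>topspace S. limitin S \<delta> p U" if U: "ultrafilter U" for U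
  proof -
    have "compactin S (topspace S)" using cS by (simp add: compact_space_def)
    then obtain p where "p \<in> topspace S" "limitin S \<delta> p U"
      by (rule compactin_ultrafilter_limit[OF _ U, of _ _ \<delta>]) (simp add: \<delta>S)
    then show ?thesis by blast
  qed
  have limF: "Lim U (\<lambda>s. F (h (\<delta> s))) = F (h p)"
    if "ultrafilter U" "limitin S \<delta> p U" "continuous_map S euclidean F" "continuous_map S S h"
    for U p h and F :: "'s \<Rightarrow> complex"
    using continuous_map_limit[OF continuous_map_compose[OF that(4,3)] that(2)]
    by (intro ultrafilter_Lim_eq[OF that(1)]) (simp add: o_def)
  \<comment> \<open>Separate continuity in \<open>S\<close> lets each inner limit, and then the
    outer one, pass through the product.\<close>
  have double: "Lim U (\<lambda>s. Lim V (\<lambda>t. pull F (s * t))) = F (m p q)"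
    "Lim V (\<lambda>t. Lim U (\<lambda>s. pull F (s * t))) = F (m p q)"
    if U: "ultrafilter U" "limitin S \<delta> p U" and V: "ultrafilter V" "limitin S \<delta> q V"
      and F: "continuous_map S euclidean F" for U V p q F
  proof -
    have pq: "p \<in> topspace S" "q \<in> topspace S" using limitin_topspace[OF U(2)] limitin_topspace[OF V(2)] .
    have "Lim V (\<lambda>t. pull F (s * t)) = F (m (\<delta> s) q)" for s
      using limF[OF V F left[OF \<delta>S[of s]]] by (simp add: pull[OF F] hom)
    then show "Lim U (\<lambda>s. Lim V (\<lambda>t. pull F (s * t))) = F (m p q)"
      using limF[OF U F right[OF pq(2)]] by simp
    have "Lim U (\<lambda>s. pull F (s * t)) = F (m p (\<delta> t))" for t
      using limF[OF U F right[OF \<delta>S[of t]]] by (simp add: pull[OF F] hom)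
    then show "Lim V (\<lambda>t. Lim U (\<lambda>s. pull F (s * t))) = F (m p q)"
      using limF[OF V F left[OF pq(1)]] by simp
  qed
  have pull_wap: "pull F \<in> wap" if F: "continuous_map S euclidean F" for F
    unfolding wap_iff_double_limits_agree[OF semitop] double_limits_agree_def
  proof (intro allI impI)
    fix U V :: "'g filter" assume U: "ultrafilter U" and V: "ultrafilter V"
    obtain p where p: "limitin S \<delta> p U" using limS[OF U] by blast
    obtain q where q: "limitin S \<delta> q V" using limS[OF V] by blast
    show "Lim U (\<lambda>s. Lim V (\<lambda>t. pull F (s * t))) = Lim V (\<lambda>t. Lim U (\<lambda>s. pull F (s * t)))"
      using double[OF U p V q F] by simp
  qed
  \<comment> \<open>\<open>p\<close> represents \<open>x\<close> when evaluation at \<open>p\<close>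
    is \<open>x\<close> transported to the continuous functions on \<open>S\<close>. Urysohn
    functions separate points, so there is at most one such \<open>p\<close>.\<close>
  define rep where "rep x p \<longleftrightarrow> p \<in> topspace S \<and> (\<forall>F. continuous_map S euclidean F \<longrightarrow> F p = x (pull F))"
    for x :: "('g \<Rightarrow>\<^sub>C complex) \<Rightarrow> complex" and p
  have repD: "F p = x (pull F)" if "rep x p" "continuous_map S euclidean F" for x p F
    using that by (simp add: rep_def)
  have rep_unique: "p = q" if r: "rep x p" "rep x q" for x p q
  proof (rule ccontr)
    assume "p \<noteq> q"
    moreover have "p \<in> topspace S" "q \<in> topspace S" using r by (auto simp: rep_def)
    ultimately obtain W where W: "openin S W" "p \<in> W" "q \<notin> W"
      using hS unfolding Hausdorff_space_def disjnt_iff by metis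
    obtain F :: "'s \<Rightarrow> complex" where F: "continuous_map S euclidean F" "F p = 0"
      "\<And>q. q \<in> topspace S - W \<Longrightarrow> F q = 1"
      by (rule Hausdorff_compact_separation[OF cS hS W(1,2)]) blast
    have "F p = F q" using repD[OF r(1) F(1)] repD[OF r(2) F(1)] by simp
    then show False using F(2) F(3)[of q] W(3) \<open>q \<in> topspace S\<close> by simp
  qed
  have rep_limit: "rep (limit_character U) p" if U: "ultrafilter U" "limitin S \<delta> p U" for U p
    unfolding rep_def
  proof (intro conjI allI impI)
    show "p \<in> topspace S" using U(2) by (rule limitin_topspace)
    fix F :: "'s \<Rightarrow> complex" assume F: "continuous_map S euclidean F"
    show "F p = limit_character U (pull F)"
      using limF[OF U F continuous_map_id[unfolded id_def]]
      by (simp add: limit_character_apply[OF pull_wap[OF F]] pull[OF F, abs_def])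
  qed
  define \<theta> where "\<theta> x = (THE p. rep x p)" for x
  have \<theta>_eq: "\<theta> x = p" if "rep x p" for x p
    unfolding \<theta>_def using that rep_unique by blast
  have obt: "\<exists>U. ultrafilter U \<and> x = limit_character U \<and> limitin S \<delta> (\<theta> x) U" if x: "x \<in> characters wap" for x
  proof -
    obtain U where U: "ultrafilter U" "x = limit_character U"
      by (rule character_is_limit_character[OF semitop x])
    obtain p where p: "limitin S \<delta> p U" using limS[OF U(1)] by blast
    have "\<theta> x = p" using rep_limit[OF U(1) p] by (intro \<theta>_eq) (simp add: U(2))
    with U p show ?thesis by blast
  qed
  have \<theta>: "rep x (\<theta> x)" if "x \<in> characters wap" for x
    using obt[OF that] rep_limit by auto
  have "continuous_map (spectrum wap) S \<theta>"
    unfolding continuous_map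
  proof (intro conjI allI impI)
    show "\<theta> ` topspace (spectrum wap) \<subseteq> topspace S"
      using \<theta> by (auto simp: rep_def)
    fix W assume W: "openin S W"
    show "openin (spectrum wap) {x \<in> topspace (spectrum wap). \<theta> x \<in> W}"
    proof (subst openin_subopen, intro ballI)
      fix x assume "x \<in> {x \<in> topspace (spectrum wap). \<theta> x \<in> W}"
      then have x: "x \<in> characters wap" "\<theta> x \<in> W" by auto
      obtain F :: "'s \<Rightarrow> complex" where F: "continuous_map S euclidean F" "F (\<theta> x) = 0"
        "\<And>q. q \<in> topspace S - W \<Longrightarrow> F q = 1"
        by (rule Hausdorff_compact_separation[OF cS hS W x(2)]) blast
      have val: "F (\<theta> y) = y (pull F)" if "y \<in> characters wap" for y
        by (rule repD[OF \<theta>[OF that] F(1)])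
      \<comment> \<open>Since \<open>F\<close> is 1 off \<open>W\<close>, a character
        \<open>y\<close> with \<open>y (pull F)\<close> in the unit ball is mapped into
        \<open>W\<close>.\<close>
      let ?N = "{y \<in> topspace (spectrum wap). y (pull F) \<in> ball 0 1}"
      have "openin (spectrum wap) ?N"
        by (rule openin_continuous_map_preimage[OF continuous_map_spectrum_apply[OF pull_wap[OF F(1)]]]) simp
      moreover have "x \<in> ?N" using x val[OF x(1)] F(2) by simp
      moreover have "?N \<subseteq> {x \<in> topspace (spectrum wap). \<theta> x \<in> W}"
      proof
        fix y assume y: "y \<in> ?N"
        then have "F (\<theta> y) \<noteq> 1" using val[of y] by auto
        moreover have "\<theta> y \<in> topspace S" using \<theta>[of y] y by (simp add: rep_def)
        ultimately show "y \<in> {x \<in> topspace (spectrum wap). \<theta> x \<in> W}" using F(3)[of "\<theta> y"] y by auto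
      qed
      ultimately show "\<exists>T. openin (spectrum wap) T \<and> x \<in> T \<and> T \<subseteq> {x \<in> topspace (spectrum wap). \<theta> x \<in> W}"
        by (intro exI[of _ ?N] conjI)
    qed
  qed
  moreover have "\<theta> (arens_product wap x y) = m (\<theta> x) (\<theta> y)"
    if x: "x \<in> characters wap" and y: "y \<in> characters wap" for x y
  proof (rule \<theta>_eq)
    obtain U where U: "ultrafilter U" "x = limit_character U" "limitin S \<delta> (\<theta> x) U"
      using obt[OF x] by blast
    obtain V where V: "ultrafilter V" "y = limit_character V" "limitin S \<delta> (\<theta> y) V"
      using obt[OF y] by blast
    show "rep (arens_product wap x y) (m (\<theta> x) (\<theta> y))"
      unfolding rep_def
    proof (intro conjI allI impI)
      show "m (\<theta> x) (\<theta> y) \<in> topspace S"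
        using \<theta>[OF x] \<theta>[OF y] by (intro closed) (auto simp: rep_def)
      fix F :: "'s \<Rightarrow> complex" assume F: "continuous_map S euclidean F"
      have "arens_product wap x y (pull F) = Lim U (\<lambda>s. Lim V (\<lambda>t. pull F (s * t)))"
        using arens_product_limit_character[OF semitop V(1) pull_wap[OF F], of U]
        by (simp only: U(2)[symmetric] V(2)[symmetric])
      also have "\<dots> = F (m (\<theta> x) (\<theta> y))" by (rule double(1)[OF U(1,3) V(1,3) F])
      finally show "F (m (\<theta> x) (\<theta> y)) = arens_product wap x y (pull F)" ..
    qed
  qed
  moreover have "\<theta> (evaluation wap s) = \<delta> s" for s
    by (rule \<theta>_eq) (simp add: rep_def \<delta>S evaluation_def pull_wap pull)
  ultimately show ?thesis
    unfolding factor_of_def by (intro exI[of _ \<theta>]) simp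
qed

theorem proposition2p14:
  fixes star :: "'g::{topological_space,semigroup_mult} \<Rightarrow> 'g"
  assumes "semitopological_semigroup (euclidean :: 'g topology) (*)"
    and "continuous_involution (euclidean :: 'g topology) (*) star"
  shows
    "(\<forall>(S :: 's topology) m.
        right_topological_semigroup S m \<and> (\<exists>starS. continuous_involution S m starS)
        \<longrightarrow> semitopological_semigroup S m) \<and>
     (\<forall>(\<delta> :: 'g \<Rightarrow> 's) S m.
        involutive_compactification star \<delta> S m
        \<longrightarrow> semitopological_semigroup S m \<and>
            isometric_involution_on (C_comp S \<delta>) (cb_star star)) \<and>
     involutive_compactification star
        (evaluation (wap :: ('g \<Rightarrow>\<^sub>C complex) set)) (spectrum wap) (arens_product wap) \<and>
     (\<forall>(\<delta> :: 'g \<Rightarrow> 's) S m.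
        involutive_compactification star \<delta> S m
        \<longrightarrow> factor_of \<delta> S m
              (evaluation (wap :: ('g \<Rightarrow>\<^sub>C complex) set)) (spectrum wap) (arens_product wap))"
proof -
  have semi: "semitopological_semigroup S m"
    if "right_topological_semigroup S m \<and> (\<exists>starS. continuous_involution S m starS)"
    for S :: "'s topology" and m
    using that semitopological_if_continuous_involution by blast
  have semi': "semitopological_semigroup S m" if "involutive_compactification star \<delta> S m"
    for \<delta> :: "'g \<Rightarrow> 's" and S m
    using that by (intro semi) (auto simp: involutive_compactification_def right_topological_compactification_def)
  have star: "continuous_on UNIV star" "\<And>s. star (star s) = s"
    using assms(2) by (auto simp: continuous_involution_def involution_on_def)
  have "isometric_involution_on (C_comp S \<delta>) (cb_star star)" if inv: "involutive_compactification star \<delta> S m"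
    for \<delta> :: "'g \<Rightarrow> 's" and S m
  proof -
    obtain starS where "continuous_involution S m starS" "\<forall>s. \<delta> (star s) = starS (\<delta> s)"
      using inv unfolding involutive_compactification_def by blast
    then show ?thesis
      by (intro isometric_involution_on_C_comp[OF star]) (auto simp: continuous_involution_def)
  qed
  moreover have "factor_of \<delta> S m
      (evaluation (wap :: ('g \<Rightarrow>\<^sub>C complex) set)) (spectrum wap) (arens_product wap)"
    if "involutive_compactification star \<delta> S m" for \<delta> :: "'g \<Rightarrow> 's" and S m
    using that by (intro factor_of_wap_compactification[OF assms(1) _ semi'[OF that]])
      (simp add: involutive_compactification_def)
  ultimately show ?thesis
    using semi semi' involutive_compactification_wap[OF assms] by blast
qed

end
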